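(* Let $G$ be an infinite compact abelian group, let $H$ be a subgroup of $G$, and let $\mathcal{F}_H$ be the filter on $\widehat{G}$ defined by $$\mathcal{F}_H := \left\{ F \subseteq \widehat{G} : \exists\, \alpha_1,\ldots,\alpha_t \in H,\ \exists\, \varepsilon>0,\ \exists\, \Gamma\subseteq \widehat{G} \text{ with } |\Gamma|<\infty, \text{ such that } B_{(\alpha_1,\ldots,\alpha_t,\varepsilon)}\cap(\widehat{G}\setminus\Gamma) \subseteq F\right\}.$$ Then for all $\beta\in G$, $$\mathcal{F}_H-\lim_{\chi} \chi(\beta) = 0 \iff \beta\in H .$$
   Context: $\mathbb{T}=\mathbb{R}/\mathbb{Z}$, written additively; for $x=r+\mathbb{Z}\in\mathbb{T}$, $\|x\|$ is the distance from $r$ to the nearest integer. $\widehat{G}$ is the group of all continuous homomorphisms $\chi: G\to\mathbb{T}$. Subgroups need not be closed. For $\alpha_1,\ldots,\alpha_t\in G$ and $\varepsilon>0$, $B_{(\alpha_1,\ldots,\alpha_t,\varepsilon)} := \{\chi\in\widehat{G} : \|\chi(\alpha_i)\|\le\varepsilon \text{ for } i=1,\ldots,t\}$. Filter limits: if $\mathcal{F}$ is a filter on a set $S$, $f:S\to X$ is a map to a topological space and $y\in X$, then $\mathcal{F}-\lim_s f(s)=y$ means that $\{s\in S: f(s)\in U\}\in\mathcal{F}$ for every neighborhood $U$ of $y$. *)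

theory Defs
  imports "HOL-Analysis.Analysis"
begin

quotient_type circle = real / "\<lambda>x y. x - y \<in> \<int>"
  morphisms rep_circle of_real_circle
proof (rule equivpI)
  show "reflp (\<lambda>x y :: real. x - y \<in> \<int>)"
    by (simp add: reflp_def)
  show "symp (\<lambda>x y :: real. x - y \<in> \<int>)"
    by (metis (no_types, lifting) Ints_minus minus_diff_eq sympI)
  show "transp (\<lambda>x y :: real. x - y \<in> \<int>)"
  proof (rule transpI)
    fix x y z :: real
    assume "x - y \<in> \<int>" "y - z \<in> \<int>"
    then have "(x - y) + (y - z) \<in> \<int>" by (rule Ints_add)
    then show "x - z \<in> \<int>" by simp
  qed
qed

instantiation circle :: ab_group_add
begin

lift_definition zero_circle :: circle is "0 :: real" .

lift_definition plus_circle :: "circle \<Rightarrow> circle \<Rightarrow> circle" is "(+)"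
proof -
  fix a b c d :: real
  assume "a - b \<in> \<int>" "c - d \<in> \<int>"
  then have "(a - b) + (c - d) \<in> \<int>" by (rule Ints_add)
  then show "(a + c) - (b + d) \<in> \<int>" by (simp add: algebra_simps)
qed

lift_definition minus_circle :: "circle \<Rightarrow> circle \<Rightarrow> circle" is "(-)"
proof -
  fix a b c d :: real
  assume "a - b \<in> \<int>" "c - d \<in> \<int>"
  then have "(a - b) - (c - d) \<in> \<int>" by (rule Ints_diff)
  then show "(a - c) - (b - d) \<in> \<int>" by (simp add: algebra_simps)
qed

lift_definition uminus_circle :: "circle \<Rightarrow> circle" is uminus
proof -
  fix a b :: real
  assume "a - b \<in> \<int>"
  then have "- (a - b) \<in> \<int>" by (rule Ints_minus)
  then show "- a - (- b) \<in> \<int>" by (simp add: algebra_simps)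
qed

instance
  by standard (transfer; simp add: algebra_simps)+

end

instantiation circle :: topological_space
begin

definition open_circle :: "circle set \<Rightarrow> bool" where
  "open_circle U \<longleftrightarrow> open (of_real_circle -` U)"

instance
  by standard (auto simp: open_circle_def vimage_Union)

end

lift_definition circle_norm :: "circle \<Rightarrow> real"
  is "\<lambda>r. \<bar>r - of_int (round r)\<bar>"
proof -
  fix x y :: real
  assume "x - y \<in> \<int>"
  then obtain n where "x - y = of_int n" by (auto elim: Ints_cases)
  then have x: "x = y + of_int n" by simp
  have "round x = round y + n"
    unfolding x round_def by (metis add.assoc add.commute floor_add_int)
  then show "\<bar>x - of_int (round x)\<bar> = \<bar>y - of_int (round y)\<bar>"
    using x by simp
qed

definition dual_group :: "('a::topological_ab_group_add \<Rightarrow> circle) set" where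
  "dual_group = {\<phi>. continuous_on UNIV \<phi> \<and> (\<forall>x y. \<phi> (x + y) = \<phi> x + \<phi> y)}"

definition is_subgroup :: "'a::ab_group_add set \<Rightarrow> bool" where
  "is_subgroup H \<longleftrightarrow> 0 \<in> H \<and> (\<forall>x\<in>H. \<forall>y\<in>H. x + y \<in> H) \<and> (\<forall>x\<in>H. - x \<in> H)"

definition bohr_nbhd :: "'a::topological_ab_group_add list \<Rightarrow> real \<Rightarrow> ('a \<Rightarrow> circle) set" where
  "bohr_nbhd \<alpha>s \<epsilon> = {\<phi> \<in> dual_group. \<forall>\<alpha>\<in>set \<alpha>s. circle_norm (\<phi> \<alpha>) \<le> \<epsilon>}"

definition char_filter_sets :: "'a::topological_ab_group_add set \<Rightarrow> ('a \<Rightarrow> circle) set set" where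
  "char_filter_sets H = {F. F \<subseteq> dual_group \<and>
     (\<exists>\<alpha>s \<epsilon> \<Gamma>. set \<alpha>s \<subseteq> H \<and> \<epsilon> > 0 \<and> \<Gamma> \<subseteq> dual_group \<and> finite \<Gamma> \<and>
        bohr_nbhd \<alpha>s \<epsilon> \<inter> (dual_group - \<Gamma>) \<subseteq> F)}"

text \<open>The same filter as an object of type \<^typ>\<open>'b filter\<close>, on the type of all functions from the
  group to the circle and concentrated on the dual group; see \<open>eventually_char_filter\<close>.\<close>

definition char_filter :: "'a::topological_ab_group_add set \<Rightarrow> ('a \<Rightarrow> circle) filter" where
  "char_filter H = Abs_filter (\<lambda>P. {\<phi> \<in> dual_group. P \<phi>} \<in> char_filter_sets H)"

lemma char_filter_sets_UNIV: "dual_group \<in> char_filter_sets H"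
  unfolding char_filter_sets_def
  by (auto intro!: exI[of _ "[]"] exI[of _ "1::real"] exI[of _ "{}"])

lemma char_filter_sets_mono:
  "A \<in> char_filter_sets H \<Longrightarrow> A \<subseteq> B \<Longrightarrow> B \<subseteq> dual_group \<Longrightarrow> B \<in> char_filter_sets H"
  unfolding char_filter_sets_def by blast

lemma char_filter_sets_Int:
  assumes "A \<in> char_filter_sets H" "B \<in> char_filter_sets H"
  shows "A \<inter> B \<in> char_filter_sets H"
proof -
  obtain as e C where 1: "A \<subseteq> dual_group" "set as \<subseteq> H" "e > 0" "C \<subseteq> dual_group" "finite C"
      "bohr_nbhd as e \<inter> (dual_group - C) \<subseteq> A"
    using assms(1) unfolding char_filter_sets_def by blast
  obtain bs d D where 2: "set bs \<subseteq> H" "d > 0" "D \<subseteq> dual_group" "finite D"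
      "bohr_nbhd bs d \<inter> (dual_group - D) \<subseteq> B"
    using assms(2) unfolding char_filter_sets_def by blast
  have "bohr_nbhd (as @ bs) (min e d) \<inter> (dual_group - (C \<union> D)) \<subseteq> A \<inter> B"
    using 1(6) 2(5) by (fastforce simp: bohr_nbhd_def)
  moreover have "set (as @ bs) \<subseteq> H" "min e d > 0" "C \<union> D \<subseteq> dual_group" "finite (C \<union> D)"
    "A \<inter> B \<subseteq> dual_group"
    using 1 2 by auto
  ultimately show ?thesis
    unfolding char_filter_sets_def by blast
qed

lemma eventually_char_filter:
  "eventually P (char_filter H) \<longleftrightarrow> {\<phi> \<in> dual_group. P \<phi>} \<in> char_filter_sets H"
  unfolding char_filter_def
proof (rule eventually_Abs_filter, standard)
  show "{\<phi> \<in> dual_group. True} \<in> char_filter_sets H"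
    using char_filter_sets_UNIV[of H] by simp
next
  fix P Q :: "('a \<Rightarrow> circle) \<Rightarrow> bool"
  assume PQ: "{\<phi> \<in> dual_group. P \<phi>} \<in> char_filter_sets H"
    "{\<phi> \<in> dual_group. Q \<phi>} \<in> char_filter_sets H"
  have "{\<phi> \<in> dual_group. P \<phi> \<and> Q \<phi>} = {\<phi> \<in> dual_group. P \<phi>} \<inter> {\<phi> \<in> dual_group. Q \<phi>}"
    by blast
  then show "{\<phi> \<in> dual_group. P \<phi> \<and> Q \<phi>} \<in> char_filter_sets H"
    using char_filter_sets_Int[OF PQ] by simp
next
  fix P Q :: "('a \<Rightarrow> circle) \<Rightarrow> bool"
  assume "\<forall>x. P x \<longrightarrow> Q x" "{\<phi> \<in> dual_group. P \<phi>} \<in> char_filter_sets H"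
  then show "{\<phi> \<in> dual_group. Q \<phi>} \<in> char_filter_sets H"
    by (elim char_filter_sets_mono) auto
qed

end

theory Submission
  imports Defs "HOL-Library.Function_Algebras"
    "HOL-Computational_Algebra.Fundamental_Theorem_Algebra"
begin

text \<open>
  For \<open>\<beta> \<in> H\<close> the sets \<open>B(\<beta>, \<epsilon>)\<close> belong to the filter by definition, so the content is the converse.

  It rests on the fact that the continuous characters separate the points of \<open>G\<close>. Averages of
  translates of a continuous function come uniformly close to a constant, its Haar mean. Given
  \<open>\<beta> \<noteq> 0\<close>, take a symmetric continuous \<open>g\<close> with \<open>g 0 \<noteq> g \<beta>\<close> and convolve with the kernel
  \<open>k x = 2 g x - g (x + \<beta>) - g (x - \<beta>)\<close>. This is a nonzero compact self-adjoint operator, and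
  its square has a nonzero eigenvalue whose eigenspace is finite-dimensional and
  translation-invariant, hence contains a character \<open>c\<close>; as \<open>c \<beta> = 1\<close> would force
  \<open>k * c = 0\<close>, we have \<open>c \<beta> \<noteq> 1\<close>.

  Now let \<open>\<xi> \<beta>\<close> be small for all but finitely many \<open>\<xi>\<close> in a Bohr neighbourhood given by
  \<open>\<alpha>\<^sub>1, \<dots>, \<alpha>\<^sub>t \<in> H\<close>. The exceptions disappear after halving the neighbourhood, since Bohr neighbourhoods
  are infinite. Suppose \<open>\<beta> \<notin> H\<close> and consider
  \<open>P \<xi> = (\<Prod>i. (1 + cos (2 pi \<xi> \<alpha>\<^sub>i)) / 2) ^ N\<close> on the dual group. Multiplied by the character
  \<open>\<xi> \<mapsto> exp (- 2 pi i \<xi> \<beta>)\<close> it becomes a combination of nontrivial characters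
  of the dual group, so it has invariant mean zero. But for large \<open>N\<close> the weight \<open>P\<close> is
  concentrated on the neighbourhood, where the real part of that character is at least 1/2,
  so the mean cannot vanish.
\<close>

section \<open>Averages of translates and invariant means\<close>

text \<open>Lists rather than finite sets, so that coinciding sums in \<open>sumlist\<close> keep
  their multiplicity and \<open>avg_sumlist\<close> is an exact identity.\<close>

definition avg :: "'b::ab_group_add list \<Rightarrow> ('b \<Rightarrow> 'c::real_vector) \<Rightarrow> 'b \<Rightarrow> 'c" where
  "avg zs f x = (\<Sum>z\<leftarrow>zs. f (x + z)) /\<^sub>R real (length zs)"

definition sumlist :: "'b::ab_group_add list \<Rightarrow> 'b list \<Rightarrow> 'b list" where
  "sumlist zs ws = concat (map (\<lambda>z. map ((+) z) ws) zs)"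

lemma length_sumlist: "length (sumlist zs ws) = length zs * length ws"
  by (induction zs) (auto simp: sumlist_def)

lemma sumlist_Nil_iff: "sumlist zs ws = [] \<longleftrightarrow> zs = [] \<or> ws = []"
  by (simp flip: length_0_conv add: length_sumlist)

lemma sum_list_sumlist: "sum_list (map f (sumlist zs ws)) = (\<Sum>z\<leftarrow>zs. \<Sum>w\<leftarrow>ws. f (z + w))"
  by (induction zs) (auto simp: sumlist_def comp_def)

lemma scaleR_sum_list:
  fixes f :: "'b \<Rightarrow> 'c::real_vector"
  shows "a *\<^sub>R sum_list (map f zs) = (\<Sum>z\<leftarrow>zs. a *\<^sub>R f z)"
  by (induction zs) (auto simp: scaleR_right_distrib)

lemma norm_sum_list_le:
  fixes f :: "'b \<Rightarrow> 'c::real_normed_vector"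
  assumes "\<And>z. z \<in> set zs \<Longrightarrow> norm (f z) \<le> e"
  shows "norm (\<Sum>z\<leftarrow>zs. f z) \<le> real (length zs) * e"
  using assms
proof (induction zs)
  case (Cons z zs)
  have "norm (f z + (\<Sum>z\<leftarrow>zs. f z)) \<le> e + real (length zs) * e"
    by (intro norm_triangle_mono Cons.IH Cons.prems) auto
  then show ?case by (simp add: algebra_simps)
qed auto

lemma avg_sumlist: "avg (sumlist zs ws) f = avg zs (avg ws f)"
proof
  fix x
  show "avg (sumlist zs ws) f x = avg zs (avg ws f) x"
    by (simp add: avg_def length_sumlist sum_list_sumlist flip: scaleR_sum_list add.assoc)
qed

lemma avg_commute: "avg zs (avg ws f) = avg ws (avg zs f)"
proof -
  have "(\<Sum>z\<leftarrow>zs. \<Sum>w\<leftarrow>ws. f (x + z + w)) = (\<Sum>w\<leftarrow>ws. \<Sum>z\<leftarrow>zs. f (x + w + z))" for x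
  proof (induction zs)
    case (Cons z zs)
    then show ?case by (simp add: sum_list_addf add.assoc add.commute[of _ z])
  qed simp
  then show ?thesis
    by (auto simp: fun_eq_iff avg_def scaleR_sum_list[symmetric])
qed

lemma avg_add: "avg zs (\<lambda>x. f x + g x) x = avg zs f x + avg zs g x"
  by (simp add: avg_def sum_list_addf scaleR_right_distrib)

lemma avg_linear:
  assumes "linear h"
  shows "avg zs (\<lambda>x. h (f x)) x = h (avg zs f x)"
proof -
  have "h (\<Sum>z\<leftarrow>zs. f (x + z)) = (\<Sum>z\<leftarrow>zs. h (f (x + z)))"
    by (induction zs) (auto simp: linear_0[OF assms] linear_add[OF assms])
  then show ?thesis by (simp add: avg_def linear_scale[OF assms])
qed

lemma avg_const:
  assumes "zs \<noteq> []"
  shows "avg zs (\<lambda>_. c) x = c"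
proof -
  have "(\<Sum>z\<leftarrow>zs. c) = real (length zs) *\<^sub>R c"
    by (induction zs) (auto simp: scaleR_left_distrib)
  then show ?thesis using assms by (simp add: avg_def)
qed

lemma avg_diff_const:
  assumes "zs \<noteq> []"
  shows "avg zs f x - c = avg zs (\<lambda>x. f x - c) x"
  using avg_add[of zs "\<lambda>x. f x - c" "\<lambda>_. c" x] assms by (simp add: avg_const)

lemma norm_avg_le:
  fixes f :: "'b::ab_group_add \<Rightarrow> 'c::real_normed_vector"
  assumes "zs \<noteq> []" "\<And>z. z \<in> set zs \<Longrightarrow> norm (f (x + z)) \<le> e"
  shows "norm (avg zs f x) \<le> e"
  using norm_sum_list_le[of zs "\<lambda>z. f (x + z)" e] assms
  by (simp add: avg_def field_simps)

lemma avg_near: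
  fixes f :: "'b::ab_group_add \<Rightarrow> 'c::real_normed_vector"
  assumes "zs \<noteq> []" "\<And>y. norm (f y - c) \<le> e"
  shows "norm (avg zs f x - c) \<le> e"
  using assms by (simp add: avg_diff_const norm_avg_le)

text \<open>Averages commute, so the constant is unique, and finitely many functions can be averaged
  simultaneously. No topology is involved: the notion serves both for the compact group and for
  its discrete dual.\<close>

definition is_mean :: "('b::ab_group_add \<Rightarrow> 'c::real_normed_vector) \<Rightarrow> 'c \<Rightarrow> bool" where
  "is_mean f c \<longleftrightarrow> (\<forall>e>0. \<exists>zs. zs \<noteq> [] \<and> (\<forall>x. norm (avg zs f x - c) \<le> e))"

lemma is_meanD: "is_mean f c \<Longrightarrow> e > 0 \<Longrightarrow> \<exists>zs. zs \<noteq> [] \<and> (\<forall>x. norm (avg zs f x - c) \<le> e)"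
  by (auto simp: is_mean_def)

lemma is_mean_unique:
  assumes "is_mean f c" "is_mean f d"
  shows "c = d"
proof (rule ccontr)
  assume "c \<noteq> d"
  define e where "e = norm (c - d) / 3"
  have e: "e > 0" using \<open>c \<noteq> d\<close> by (simp add: e_def)
  obtain zs where zs: "zs \<noteq> []" "\<And>x. norm (avg zs f x - c) \<le> e" using is_meanD[OF assms(1) e] by blast
  obtain ws where ws: "ws \<noteq> []" "\<And>x. norm (avg ws f x - d) \<le> e" using is_meanD[OF assms(2) e] by blast
  \<comment> \<open>Averaging again keeps a function within \<open>e\<close> of its constant. Taken
    in both orders, one double average lies within \<open>e\<close> of both \<open>c\<close> and
    \<open>d\<close>, which are \<open>3 * e\<close> apart.\<close>
  have "norm (avg ws (avg zs f) 0 - c) \<le> e" by (rule avg_near) (use zs ws in auto)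
  moreover have "norm (avg ws (avg zs f) 0 - d) \<le> e"
    unfolding avg_commute[of ws] by (rule avg_near) (use zs ws in auto)
  ultimately have "norm (c - d) \<le> e + e"
    by (metis norm_minus_commute dist_norm dist_triangle_le add_mono dist_commute)
  then show False using e by (simp add: e_def)
qed

lemma is_mean_family:
  assumes "finite I" "\<And>i. i \<in> I \<Longrightarrow> is_mean (f i) (c i)" "e > 0"
  shows "\<exists>zs. zs \<noteq> [] \<and> (\<forall>i\<in>I. \<forall>x. norm (avg zs (f i) x - c i) \<le> e)"
  using assms
proof (induction I)
  case empty
  \<comment> \<open>With no function to control, any one-element list serves.\<close>
  then show ?case by (auto intro!: exI[of _ "[undefined]"])
next
  case (insert i I)
  then obtain zs where zs: "zs \<noteq> []" "\<And>i x. i\<in>I \<Longrightarrow> norm (avg zs (f i) x - c i) \<le> e" by auto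
  obtain ws where ws: "ws \<noteq> []" "\<And>x. norm (avg ws (f i) x - c i) \<le> e"
    using is_meanD[of "f i" "c i" e] insert by auto
  \<comment> \<open>The combined list averages by \<open>ws\<close> and by \<open>zs\<close>. For
    each function the list that brings it near its constant can be applied first, and the other list
    does no harm.\<close>
  have "norm (avg (sumlist zs ws) (f i) x - c i) \<le> e" for x
    unfolding avg_sumlist by (rule avg_near) (use zs ws in auto)
  moreover have "norm (avg (sumlist zs ws) (f j) x - c j) \<le> e" if "j \<in> I" for j x
    unfolding avg_sumlist avg_commute[of zs] by (rule avg_near) (use zs ws that in auto)
  ultimately show ?case using zs ws
    by (intro exI[of _ "sumlist zs ws"]) (auto simp: sumlist_Nil_iff)
qed

lemma is_mean_const: "is_mean (\<lambda>_. c) c"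
  unfolding is_mean_def by (auto intro!: exI[of _ "[undefined]"] simp: avg_const)

lemma is_mean_add:
  assumes "is_mean f c" "is_mean g d"
  shows "is_mean (\<lambda>x. f x + g x) (c + d)"
  unfolding is_mean_def
proof safe
  fix e :: real assume e: "e > 0"
  have "\<exists>zs. zs \<noteq> [] \<and> (\<forall>i\<in>UNIV. \<forall>x. norm (avg zs (if i then f else g) x - (if i then c else d)) \<le> e / 2)"
    using assms e by (intro is_mean_family) auto
  then obtain zs where zs: "zs \<noteq> []" "\<And>i x. norm (avg zs (if i then f else g) x - (if i then c else d)) \<le> e / 2"
    by blast
  have "norm (avg zs (\<lambda>x. f x + g x) x - (c + d)) \<le> e" for x
  proof -
    have "avg zs (\<lambda>x. f x + g x) x - (c + d) = (avg zs f x - c) + (avg zs g x - d)"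
      by (simp add: avg_add)
    also have "norm \<dots> \<le> e/2 + e/2" using zs(2)[of True x] zs(2)[of False x]
      by (intro norm_triangle_mono) auto
    finally show ?thesis by simp
  qed
  then show "\<exists>zs. zs \<noteq> [] \<and> (\<forall>x. norm (avg zs (\<lambda>x. f x + g x) x - (c + d)) \<le> e)" using zs by blast
qed

lemma is_mean_bounded_linear:
  assumes "bounded_linear h" "is_mean f c"
  shows "is_mean (\<lambda>x. h (f x)) (h c)"
  unfolding is_mean_def
proof safe
  fix e :: real assume e: "e > 0"
  interpret bounded_linear h by fact
  obtain K where K: "K > 0" "\<And>x. norm (h x) \<le> norm x * K" using pos_bounded by blast
  obtain zs where zs: "zs \<noteq> []" "\<And>x. norm (avg zs f x - c) \<le> e / K"
    using is_meanD[OF assms(2), of "e/K"] e K by auto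
  have "norm (avg zs (\<lambda>x. h (f x)) x - h c) \<le> e" for x
  proof -
    have "avg zs (\<lambda>x. h (f x)) x - h c = h (avg zs f x - c)"
      using avg_linear[of h zs f x] by (simp add: linear_axioms diff)
    also have "norm \<dots> \<le> norm (avg zs f x - c) * K" by (rule K)
    also have "\<dots> \<le> e" using zs(2)[of x] K by (simp add: field_simps)
    finally show ?thesis .
  qed
  then show "\<exists>zs. zs \<noteq> [] \<and> (\<forall>x. norm (avg zs (\<lambda>x. h (f x)) x - h c) \<le> e)" using zs by blast
qed

lemma is_mean_translate:
  assumes "is_mean f c"
  shows "is_mean (\<lambda>x. f (x + a)) c"
proof -
  have "avg zs (\<lambda>x. f (x + a)) x = avg zs f (x + a)" for zs x
    by (simp add: avg_def algebra_simps)
  then show ?thesis using assms unfolding is_mean_def by metis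
qed

lemma is_mean_norm_le:
  assumes "is_mean f c" "\<And>x. norm (f x) \<le> C"
  shows "norm c \<le> C"
proof (rule field_le_epsilon)
  fix e :: real assume "e > 0"
  then obtain zs where zs: "zs \<noteq> []" "\<And>x. norm (avg zs f x - c) \<le> e" using is_meanD assms by blast
  have "norm (avg zs f 0) \<le> C" by (rule norm_avg_le) (use zs assms in auto)
  with zs(2)[of 0] show "norm c \<le> C + e"
    by (metis add_mono_thms_linordered_semiring(1) norm_minus_commute norm_triangle_sub order_trans)
qed

lemma is_mean_nonneg:
  fixes c :: real
  assumes "is_mean f c" "\<And>x. f x \<ge> 0"
  shows "c \<ge> 0"
proof (rule field_le_epsilon)
  fix e :: real assume "e > 0"
  then obtain zs where zs: "zs \<noteq> []" "\<And>x. norm (avg zs f x - c) \<le> e" using is_meanD assms by blast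
  have "avg zs f 0 \<ge> 0" unfolding avg_def using assms(2) by (auto intro!: sum_list_nonneg mult_nonneg_nonneg)
  with zs(2)[of 0] show "0 \<le> c + e" by (auto simp: abs_le_iff)
qed

section \<open>The mean on a compact group\<close>

text \<open>On continuous functions over a compact group this is the normalised Haar integral.
  Existence there is \<open>is_mean_mean\<close>; where no mean exists the value is
  unspecified.\<close>

definition mean :: "('b::ab_group_add \<Rightarrow> complex) \<Rightarrow> complex" where
  "mean f = (THE c. is_mean f c)"

lemma mean_eqI: "is_mean f c \<Longrightarrow> mean f = c"
  unfolding mean_def using is_mean_unique by blast

lemma member_le_sum_list_real:
  fixes f :: "'b \<Rightarrow> real"
  assumes "z \<in> set zs" "\<And>z. z \<in> set zs \<Longrightarrow> f z \<ge> 0"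
  shows "f z \<le> (\<Sum>z\<leftarrow>zs. f z)"
  using assms
proof (induction zs)
  case (Cons w zs)
  have "(\<Sum>z\<leftarrow>zs. f z) \<ge> 0" using Cons.prems by (auto intro!: sum_list_nonneg)
  then show ?case using Cons by fastforce
qed auto

lemma is_mean_avg:
  assumes "is_mean f c" "ps \<noteq> []"
  shows "is_mean (avg ps f) c"
  unfolding is_mean_def
proof safe
  fix e :: real assume "e > 0"
  then obtain zs where zs: "zs \<noteq> []" "\<And>x. norm (avg zs f x - c) \<le> e" using is_meanD assms by blast
  have "norm (avg zs (avg ps f) x - c) \<le> e" for x
    unfolding avg_commute[of zs] by (rule avg_near) (use zs assms in auto)
  then show "\<exists>zs. zs \<noteq> [] \<and> (\<forall>x. norm (avg zs (avg ps f) x - c) \<le> e)" using zs by blast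
qed

text \<open>Compactness is not a type class, so the locale fixes the type of the group.\<close>

locale compact_ab_group =
  fixes G :: "'a::topological_ab_group_add itself"
  assumes compact_UNIV: "compact (UNIV :: 'a set)"
begin

text \<open>Translation by \<open>v - x\<close> carries \<open>x\<close> into \<open>V\<close>, so
  the preimages of \<open>V\<close> under translations cover the group and compactness selects
  finitely many.\<close>

lemma finite_translates_cover:
  fixes V :: "'a set"
  assumes "open V" "V \<noteq> {}"
  shows "\<exists>ps. ps \<noteq> [] \<and> (\<forall>x. \<exists>p\<in>set ps. x + p \<in> V)"
proof -
  have op: "open ((\<lambda>x. x + p) -` V)" for p
    by (intro open_vimage assms continuous_intros)
  obtain v where "v \<in> V" using assms by blast
  then have "x \<in> (\<lambda>x. x + (v - x)) -` V" for x by simp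
  then have "UNIV \<subseteq> (\<Union>p\<in>UNIV. (\<lambda>x. x + p) -` V)"
    by blast
  then obtain P where P: "finite P" "UNIV \<subseteq> (\<Union>p\<in>P. (\<lambda>x. x + p) -` V)"
    by (rule compactE_image[OF compact_UNIV, rotated]) (use op in auto)
  obtain ps where ps: "set ps = P" using P finite_list by blast
  have "\<exists>p\<in>set ps. x + p \<in> V" for x using P(2) ps by blast
  moreover from this have "ps \<noteq> []" by fastforce
  ultimately show ?thesis by blast
qed

text \<open>Uniform continuity phrased by a neighbourhood of 0, as the group carries no metric: near
  \<open>v = 0\<close> the map \<open>(v, x) \<mapsto> f (x + v)\<close> varies little, uniformly in
  the compact variable \<open>x\<close>.\<close>

lemma unif_cont:
  fixes f :: "'a \<Rightarrow> 'c::metric_space"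
  assumes "continuous_on UNIV f" "e > 0"
  shows "\<exists>V. open V \<and> 0 \<in> V \<and> (\<forall>x. \<forall>v\<in>V. dist (f (x + v)) (f x) \<le> e)"
proof -
  have c: "continuous_on (UNIV \<times> UNIV) (\<lambda>z::'a\<times>'a. f (snd z + fst z))"
    by (intro continuous_on_compose2[OF assms(1)] continuous_intros) auto
  from continuous_on_prod_compactE[OF c compact_UNIV UNIV_I assms(2), of 0]
  obtain V where V: "0 \<in> V" "open V" "\<forall>x\<in>V \<inter> UNIV. \<forall>t\<in>UNIV. dist (f (snd (x, t) + fst (x, t))) (f (snd (0::'a, t) + fst (0::'a, t))) \<le> e"
    by blast
  then have "dist (f (x + v)) (f x) \<le> e" if "v \<in> V" for x v
    using that by auto
  with V show ?thesis by blast
qed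

lemma bounded_cont:
  fixes f :: "'a \<Rightarrow> 'c::real_normed_vector"
  assumes "continuous_on UNIV f"
  obtains B where "B > 0" "\<And>x. norm (f x) \<le> B"
  using compact_imp_bounded[OF compact_continuous_image[OF assms compact_UNIV]]
  unfolding bounded_pos by auto

text \<open>The mean is the infimum \<open>s\<close> of the suprema of all averages. If the supremum of an average is
  within \<open>\<eta>\<close> of \<open>s\<close>, then no value of it can lie far below \<open>s\<close>: otherwise it would be
  small on a translate of a fixed neighbourhood, and averaging over the finitely many translates that cover
  the group would push the supremum below \<open>s\<close>.\<close>

theorem real_mean_exists:
  fixes f :: "'a \<Rightarrow> real"
  assumes cont: "continuous_on UNIV f"
  shows "\<exists>s. is_mean f s"
proof -
  obtain B where B: "\<And>x. norm (f x) \<le> B" using bounded_cont[OF cont] by blast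
  have avB: "\<bar>avg zs f x\<bar> \<le> B" if "zs \<noteq> []" for zs x
    using norm_avg_le[of zs f x B] B that by auto
  define S where "S zs = (SUP x. avg zs f x)" for zs
  have avS: "avg zs f x \<le> S zs" if "zs \<noteq> []" for zs x
    unfolding S_def using avB[OF that] by (intro cSUP_upper bdd_aboveI[of _ B]) (auto simp: abs_le_iff)
  define s where "s = Inf (S ` {zs. zs \<noteq> []})"
  have bdd: "bdd_below (S ` {zs. zs \<noteq> []})"
  proof (rule bdd_belowI[of _ "- B"], safe)
    fix zs :: "'a list" assume "zs \<noteq> []"
    from avB[OF this, of 0] avS[OF this, of 0] show "- B \<le> S zs" by simp
  qed
  have sS: "s \<le> S zs" if "zs \<noteq> []" for zs
    unfolding s_def using that bdd by (intro cINF_lower) auto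
  have "\<exists>zs. zs \<noteq> [] \<and> (\<forall>x. norm (avg zs f x - s) \<le> e)" if e: "e > 0" for e
  proof -
    obtain V where V: "open V" "0 \<in> V" "\<And>x v. v \<in> V \<Longrightarrow> dist (f (x + v)) (f x) \<le> e / 2"
      using unif_cont[OF cont, of "e/2"] e by auto
    obtain ps where ps: "ps \<noteq> []" "\<And>x. \<exists>p\<in>set ps. x + p \<in> V"
      using finite_translates_cover[of V] V by blast
    define n where "n = real (length ps)"
    have n: "n \<ge> 1" using ps(1) by (cases ps) (auto simp: n_def)
    \<comment> \<open>Small enough that the factor \<open>n\<close> lost in averaging over the cover
      costs only \<open>e / 2\<close>.\<close>
    define \<eta> where "\<eta> = e / (2 * n)"
    have \<eta>: "\<eta> > 0" "n * \<eta> = e / 2" using n e by (auto simp: \<eta>_def)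
    have "\<eta> \<le> n * \<eta>" using n \<eta> by simp
    have "Inf (S ` {zs. zs \<noteq> []}) < s + \<eta>" using \<eta> by (simp add: s_def)
    then obtain zs where zs: "zs \<noteq> []" "S zs < s + \<eta>"
      by (subst (asm) cInf_less_iff) (use bdd in auto)
    define h where "h = avg zs f"
    have hS: "h x \<le> s + \<eta>" for x using avS[OF zs(1), of x] zs(2) by (simp add: h_def)
    have hV: "\<bar>h (x + v) - h x\<bar> \<le> e / 2" if "v \<in> V" for x v
    proof -
      have "h (x + v) - h x = avg zs (\<lambda>x. f (x + v) + - f x) x"
        unfolding avg_add h_def using avg_linear[of uminus zs f x]
        by (simp add: avg_def linear_uminus algebra_simps module_hom_uminus)
      also have "norm \<dots> \<le> e / 2"
        by (rule norm_avg_le) (use zs V(3)[OF that] in \<open>auto simp: dist_norm\<close>)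
      finally show ?thesis by simp
    qed
    have low: "h x0 \<ge> s - e" for x0
    proof -
      \<comment> \<open>Some translate \<open>x + p\<close> falls into \<open>x0 + V\<close>, where
        \<open>h\<close> is at most \<open>h x0 + e/2\<close>. The other terms are at most
        \<open>s + \<eta>\<close>, so this single deficit, divided by \<open>n\<close>, lowers the
        average.\<close>
      have ub: "avg ps h x \<le> s + \<eta> - (s + \<eta> - h x0 - e/2) / n" for x
      proof -
        obtain p where p: "p \<in> set ps" "x - x0 + p \<in> V" using ps(2) by blast
        have "x0 + (x - x0 + p) = x + p" by simp
        then have "h (x + p) \<le> h x0 + e/2" using hV[OF p(2), of x0] abs_ge_self[of "h (x + p) - h x0"]
          by simp
        then have "s + \<eta> - h x0 - e/2 \<le> s + \<eta> - h (x + p)" by simp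
        also have "\<dots> \<le> (\<Sum>p\<leftarrow>ps. s + \<eta> - h (x + p))"
          by (rule member_le_sum_list_real[OF p(1)]) (use hS in \<open>auto simp: algebra_simps\<close>)
        also have "\<dots> = n * (s + \<eta>) - n * avg ps h x"
          using ps(1) by (simp add: avg_def n_def sum_list_subtractf sum_list_triv)
        finally show ?thesis using n by (simp add: field_simps)
      qed
      \<comment> \<open>\<open>avg ps h\<close> is itself an average of \<open>f\<close>, so its
        supremum is at least \<open>s\<close>; this bounds the deficit by
        \<open>n * \<eta>\<close>.\<close>
      have "s \<le> S (sumlist ps zs)" using sS ps zs by (simp add: sumlist_Nil_iff)
      also have "\<dots> \<le> s + \<eta> - (s + \<eta> - h x0 - e/2) / n"
        unfolding S_def avg_sumlist using ub by (intro cSUP_least) (auto simp: h_def)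
      finally have "s + \<eta> - h x0 - e/2 \<le> n * \<eta>" using n by (simp add: field_simps)
      then show ?thesis using \<eta> by simp
    qed
    have "\<eta> \<le> e" using \<open>\<eta> \<le> n * \<eta>\<close> \<eta> e by linarith
    then have "norm (avg zs f x - s) \<le> e" for x
      using low[of x] hS[of x] unfolding h_def real_norm_def by linarith
    then show ?thesis using zs by blast
  qed
  then show ?thesis unfolding is_mean_def by blast
qed

theorem is_mean_mean:
  fixes f :: "'a \<Rightarrow> complex"
  assumes cont: "continuous_on UNIV f"
  shows "is_mean f (mean f)"
proof -
  obtain a where a: "is_mean (\<lambda>x. Re (f x)) a" using real_mean_exists[of "\<lambda>x. Re (f x)"] cont
    by (auto intro: continuous_intros)
  obtain b where b: "is_mean (\<lambda>x. Im (f x)) b" using real_mean_exists[of "\<lambda>x. Im (f x)"] cont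
    by (auto intro: continuous_intros)
  have "is_mean (\<lambda>x. of_real (Re (f x)) + \<i> * of_real (Im (f x))) (of_real a + \<i> * of_real b)"
    by (intro is_mean_add is_mean_bounded_linear[OF bounded_linear_of_real a]
         is_mean_bounded_linear[OF _ b] bounded_linear_const_mult bounded_linear_of_real)
  moreover have "(\<lambda>x. of_real (Re (f x)) + \<i> * of_real (Im (f x))) = f"
    by (rule ext) (rule complex_eq[symmetric])
  ultimately have "is_mean f (of_real a + \<i> * of_real b)" by simp
  with mean_eqI[OF this] show ?thesis by simp
qed

lemma mean_add:
  assumes "continuous_on UNIV (f::'a\<Rightarrow>complex)" "continuous_on UNIV g"
  shows "mean (\<lambda>x. f x + g x) = mean f + mean g"
  by (rule mean_eqI[OF is_mean_add[OF is_mean_mean[OF assms(1)] is_mean_mean[OF assms(2)]]])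

lemma mean_linear:
  assumes "continuous_on UNIV (f::'a\<Rightarrow>complex)" "bounded_linear h"
  shows "mean (\<lambda>x. h (f x)) = h (mean f)"
  by (rule mean_eqI[OF is_mean_bounded_linear[OF assms(2) is_mean_mean[OF assms(1)]]])

lemma mean_cmult:
  assumes "continuous_on UNIV (f::'a\<Rightarrow>complex)"
  shows "mean (\<lambda>x. c * f x) = c * mean f" "mean (\<lambda>x. f x * c) = mean f * c"
  using mean_linear[OF assms bounded_linear_mult_right[of c]]
    mean_linear[OF assms bounded_linear_mult_left[of c]] by simp_all

lemma mean_cnj:
  assumes "continuous_on UNIV (f::'a\<Rightarrow>complex)"
  shows "mean (\<lambda>x. cnj (f x)) = cnj (mean f)"
  using mean_linear[OF assms bounded_linear_cnj] .

lemma mean_diff: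
  assumes "continuous_on UNIV (f::'a\<Rightarrow>complex)" "continuous_on UNIV g"
  shows "mean (\<lambda>x. f x - g x) = mean f - mean g"
  using mean_add[OF assms(1), of "\<lambda>x. - g x"] mean_cmult(1)[OF assms(2), of "-1"] assms
  by (simp add: continuous_on_minus)

lemma mean_const: "mean (\<lambda>_::'a. c) = c"
  by (intro mean_eqI is_mean_const)

lemma mean_sum:
  assumes "\<And>i. i \<in> I \<Longrightarrow> continuous_on UNIV (f i :: 'a\<Rightarrow>complex)"
  shows "mean (\<lambda>x. \<Sum>i\<in>I. f i x) = (\<Sum>i\<in>I. mean (f i))"
  using assms
proof (induction I rule: infinite_finite_induct)
  case (insert i I)
  then show ?case using mean_add[of "f i" "\<lambda>x. \<Sum>i\<in>I. f i x"] by (simp add: continuous_on_sum)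
qed (auto simp: mean_const)

lemma mean_translate:
  assumes "continuous_on UNIV (f::'a\<Rightarrow>complex)"
  shows "mean (\<lambda>x. f (x + a)) = mean f"
  by (rule mean_eqI[OF is_mean_translate[OF is_mean_mean[OF assms]]])

lemma norm_mean_le:
  assumes "continuous_on UNIV (f::'a\<Rightarrow>complex)" "\<And>x. norm (f x) \<le> C"
  shows "norm (mean f) \<le> C"
  using is_mean_norm_le[OF is_mean_mean] assms by blast

lemma mean_near:
  assumes "continuous_on UNIV (f::'a\<Rightarrow>complex)" "continuous_on UNIV g" "\<And>x. norm (f x - g x) \<le> C"
  shows "norm (mean f - mean g) \<le> C"
  using norm_mean_le[of "\<lambda>x. f x - g x" C] assms by (simp add: mean_diff continuous_on_diff)

lemma mean_real:
  assumes "continuous_on UNIV (f::'a\<Rightarrow>real)"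
  shows "is_mean f (Re (mean (\<lambda>x. of_real (f x))))" "Im (mean (\<lambda>x. of_real (f x))) = 0"
proof -
  have c: "continuous_on UNIV (\<lambda>x. complex_of_real (f x))" using assms by (intro continuous_intros)
  show "is_mean f (Re (mean (\<lambda>x. of_real (f x))))"
    using is_mean_bounded_linear[OF bounded_linear_Re is_mean_mean[OF c]] by simp
  show "Im (mean (\<lambda>x. of_real (f x))) = 0"
    using mean_linear[OF c bounded_linear_cnj] by (simp add: complex_eq_iff)
qed

text \<open>Strict positivity of the mean. A positive value persists, up to a factor 1/2, on an open
  set; averaging over translates that cover the group gives a function bounded below by
  \<open>d > 0\<close>, although its mean is still 0.\<close>

lemma is_mean_zero_imp:
  fixes f :: "'a \<Rightarrow> real"
  assumes cont: "continuous_on UNIV f" and nn: "\<And>x. f x \<ge> 0" and m: "is_mean f 0"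
  shows "f x = 0"
proof (rule ccontr)
  assume "f x \<noteq> 0"
  then have pos: "f x > 0" using nn[of x] by simp
  define V where "V = f -` {f x / 2 <..}"
  have "open V" "x \<in> V" unfolding V_def using cont pos by (auto intro!: open_vimage)
  then obtain ps where ps: "ps \<noteq> []" "\<And>x. \<exists>p\<in>set ps. x + p \<in> V"
    using finite_translates_cover[of V] by blast
  define d where "d = f x / 2 / real (length ps)"
  have d: "d > 0" using pos ps(1) by (simp add: d_def)
  have "avg ps f y \<ge> d" for y
  proof -
    obtain p where p: "p \<in> set ps" "y + p \<in> V" using ps(2) by blast
    have "f x / 2 \<le> f (y + p)" using p(2) by (simp add: V_def)
    also have "\<dots> \<le> (\<Sum>p\<leftarrow>ps. f (y + p))"
      by (rule member_le_sum_list_real[OF p(1)]) (use nn in auto)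
    finally show ?thesis using ps(1) by (simp add: avg_def d_def field_simps)
  qed
  then have nn': "avg ps f y + - d \<ge> 0" for y by (simp add: le_diff_eq)
  have "is_mean (\<lambda>y. avg ps f y + (- d)) (0 + (- d))"
    by (rule is_mean_add[OF is_mean_avg[OF m ps(1)] is_mean_const])
  from is_mean_nonneg[OF this nn'] show False using d by simp
qed

section \<open>Means depending on a parameter, and the interchange of two means\<close>

context
  fixes F :: "'a \<times> 'a \<Rightarrow> complex"
  assumes F: "continuous_on UNIV F"
begin

lemma cont_fst_snd: "continuous_on UNIV (\<lambda>y. F (x, y))" "continuous_on UNIV (\<lambda>y. F (y, x))"
  by (auto intro!: continuous_on_compose2[OF F] continuous_intros)

lemma unif_fst:
  assumes "e > 0"
  obtains X where "x \<in> X" "open X" "\<And>x' y. x' \<in> X \<Longrightarrow> norm (F (x', y) - F (x, y)) \<le> e"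
proof -
  have c: "continuous_on (UNIV \<times> UNIV) F" using F by simp
  from continuous_on_prod_compactE[OF c compact_UNIV UNIV_I assms, of x]
  obtain X where "x \<in> X" "open X" "\<forall>x'\<in>X \<inter> UNIV. \<forall>y\<in>UNIV. dist (F (x', y)) (F (x, y)) \<le> e"
    by blast
  then show ?thesis using that[of X] by (simp add: dist_norm)
qed

lemma continuous_mean: "continuous_on UNIV (\<lambda>x. mean (\<lambda>y. F (x, y)))"
  unfolding continuous_on_def
proof
  fix x :: 'a
  show "((\<lambda>x. mean (\<lambda>y. F (x, y))) \<longlongrightarrow> mean (\<lambda>y. F (x, y))) (at x)"
    unfolding tendsto_iff
  proof safe
    fix e :: real assume e: "e > 0"
    then obtain X where X: "x \<in> X" "open X" "\<And>x' y. x' \<in> X \<Longrightarrow> norm (F (x', y) - F (x, y)) \<le> e / 2"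
      using unif_fst[of "e/2"] by auto
    have "norm (mean (\<lambda>y. F (x', y)) - mean (\<lambda>y. F (x, y))) \<le> e / 2" if "x' \<in> X" for x'
      by (intro mean_near cont_fst_snd X that)
    then have "\<forall>x'\<in>X. dist (mean (\<lambda>y. F (x', y))) (mean (\<lambda>y. F (x, y))) < e"
      using e by (fastforce simp: dist_norm)
    then show "\<forall>\<^sub>F x' in at x. dist (mean (\<lambda>y. F (x', y))) (mean (\<lambda>y. F (x, y))) < e"
      using X by (auto simp: eventually_at_topological)
  qed
qed

end

text \<open>By compactness finitely many sections \<open>F (p, _)\<close> approximate all sections
  uniformly. One list of translates averages these and \<open>g\<close> at once, so the inner mean
  is uniformly close to a finite average, which commutes with the outer mean by linearity.\<close>

theorem mean_swap:
  fixes F :: "'a \<times> 'a \<Rightarrow> complex"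
  assumes F: "continuous_on UNIV F"
  shows "mean (\<lambda>x. mean (\<lambda>y. F (x, y))) = mean (\<lambda>y. mean (\<lambda>x. F (x, y)))"
proof -
  have F': "continuous_on UNIV (\<lambda>(x, y). F (y, x))"
    unfolding case_prod_beta by (intro continuous_on_compose2[OF F] continuous_intros) auto
  define g where "g y = mean (\<lambda>x. F (x, y))" for y
  define h where "h x = mean (\<lambda>y. F (x, y))" for x
  have g: "continuous_on UNIV g" using continuous_mean[OF F'] by (simp add: g_def[abs_def])
  have h: "continuous_on UNIV h" using continuous_mean[OF F] by (simp add: h_def[abs_def])
  have "norm (mean h - mean g) \<le> 4 * e" if e: "e > 0" for e
  proof -
    have "\<exists>X. x \<in> X \<and> open X \<and> (\<forall>x'\<in>X. \<forall>y. norm (F (x', y) - F (x, y)) \<le> e)" for x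
      using unif_fst[OF F e, of x] by metis
    then obtain X where X: "\<And>x. x \<in> X x" "\<And>x. open (X x)"
      "\<And>x x' y. x' \<in> X x \<Longrightarrow> norm (F (x', y) - F (x, y)) \<le> e"
      by metis
    have "UNIV \<subseteq> (\<Union>x\<in>UNIV. X x)" using X by blast
    then obtain P where P: "finite P" "UNIV \<subseteq> (\<Union>p\<in>P. X p)"
      by (rule compactE_image[OF compact_UNIV, rotated]) (use X in auto)
    define \<Phi> where "\<Phi> = insert g ((\<lambda>p y. F (p, y)) ` P)"
    have "\<exists>zs. zs \<noteq> [] \<and> (\<forall>f\<in>\<Phi>. \<forall>x. norm (avg zs f x - mean f) \<le> e)"
      by (rule is_mean_family) (use P e cont_fst_snd[OF F] g in \<open>auto simp: \<Phi>_def intro!: is_mean_mean\<close>)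
    then obtain zs where zs: "zs \<noteq> []" "\<And>f x. f \<in> \<Phi> \<Longrightarrow> norm (avg zs f x - mean f) \<le> e" by blast
    have 1: "norm (avg zs (\<lambda>y. F (x, y)) 0 - h x) \<le> 3 * e" for x
    proof -
      obtain p where p: "p \<in> P" "x \<in> X p" using P(2) by blast
      have a: "norm (avg zs (\<lambda>y. F (x, y) - F (p, y)) 0) \<le> e"
        by (rule norm_avg_le) (use X(3)[OF p(2)] zs in auto)
      have "avg zs (\<lambda>y. F (x, y)) 0 = avg zs (\<lambda>y. F (x, y) - F (p, y)) 0 + avg zs (\<lambda>y. F (p, y)) 0"
        using avg_add[of zs "\<lambda>y. F (x, y) - F (p, y)" "\<lambda>y. F (p, y)"] by simp
      then have "avg zs (\<lambda>y. F (x, y)) 0 - h x = avg zs (\<lambda>y. F (x, y) - F (p, y)) 0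
         + ((avg zs (\<lambda>y. F (p, y)) 0 - mean (\<lambda>y. F (p, y))) + (h p - h x))"
        by (simp add: h_def)
      also have "norm \<dots> \<le> e + (e + e)"
      proof (intro norm_triangle_mono a)
        show "norm (avg zs (\<lambda>y. F (p, y)) 0 - mean (\<lambda>y. F (p, y))) \<le> e"
          by (rule zs) (use p in \<open>auto simp: \<Phi>_def\<close>)
        show "norm (h p - h x) \<le> e" unfolding h_def
          by (intro mean_near cont_fst_snd[OF F]) (use X(3)[OF p(2)] in \<open>auto simp: norm_minus_commute\<close>)
      qed
      finally show ?thesis by simp
    qed
    have "mean (\<lambda>x. \<Sum>z\<leftarrow>zs. F (x, z)) = (\<Sum>z\<leftarrow>zs. g z) \<and> continuous_on UNIV (\<lambda>x. \<Sum>z\<leftarrow>zs. F (x, z))"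
    proof (induction zs)
      case (Cons z zs)
      then show ?case using cont_fst_snd[OF F] by (auto simp: mean_add g_def intro!: continuous_intros)
    qed (auto simp: mean_const)
    then have 2: "mean (\<lambda>x. avg zs (\<lambda>y. F (x, y)) 0) = avg zs g 0"
      "continuous_on UNIV (\<lambda>x. avg zs (\<lambda>y. F (x, y)) 0)"
      using mean_linear[OF _ bounded_linear_scaleR_right[of "inverse (real (length zs))"],
          of "\<lambda>x. \<Sum>z\<leftarrow>zs. F (x, z)"]
      by (auto simp: avg_def intro!: continuous_intros)
    have "norm (mean (\<lambda>x. avg zs (\<lambda>y. F (x, y)) 0) - mean h) \<le> 3 * e"
      by (intro mean_near 2 h 1)
    moreover have "norm (avg zs g 0 - mean g) \<le> e" by (rule zs) (auto simp: \<Phi>_def)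
    ultimately have "norm ((avg zs g 0 - mean g) - (avg zs g 0 - mean h)) \<le> e + 3 * e" unfolding 2(1)
      using norm_triangle_ineq4[of "avg zs g 0 - mean g" "avg zs g 0 - mean h"] by linarith
    then show ?thesis by simp
  qed
  \<comment> \<open>Here \<open>4 * e\<close> is half of the norm being bounded, so that norm
    vanishes.\<close>
  from this[of "norm (mean h - mean g) / 8"] have "mean h = mean g" by fastforce
  then show ?thesis by (simp add: g_def[abs_def] h_def[abs_def])
qed

end

section \<open>The inner product given by the mean\<close>

definition ip :: "('b::ab_group_add \<Rightarrow> complex) \<Rightarrow> ('b \<Rightarrow> complex) \<Rightarrow> complex" where
  "ip f g = mean (\<lambda>x. f x * cnj (g x))"

definition nrm :: "('b::ab_group_add \<Rightarrow> complex) \<Rightarrow> real" where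
  "nrm f = sqrt (Re (ip f f))"

text \<open>Total boundedness of bounded sets of complex vectors indexed by \<open>P\<close>, with
  the net taken from the family itself. It serves both Arzela-Ascoli and the covering of the dual by
  translates of Bohr neighbourhoods.\<close>

lemma finite_net:
  fixes \<Phi> :: "'i \<Rightarrow> 'p \<Rightarrow> complex"
  assumes "finite P" "\<And>i p. i \<in> I \<Longrightarrow> p \<in> P \<Longrightarrow> norm (\<Phi> i p) \<le> C" "\<delta> > 0"
  shows "\<exists>J\<subseteq>I. finite J \<and> (\<forall>i\<in>I. \<exists>j\<in>J. \<forall>p\<in>P. norm (\<Phi> i p - \<Phi> j p) \<le> \<delta>)"
  using assms(1,2)
proof (induction P arbitrary: I)
  case empty
  show ?case
  proof (cases "I = {}")
    case False
    then obtain i where "i \<in> I" by blast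
    then show ?thesis by (intro exI[of _ "{i}"]) auto
  qed auto
next
  case (insert p P)
  have "compact (cball (0::complex) C)" by simp
  then obtain Z where Z: "finite Z" "cball (0::complex) C \<subseteq> (\<Union>z\<in>Z. ball z (\<delta>/2))"
    using assms(3) unfolding compact_eq_totally_bounded by (metis half_gt_zero)
  \<comment> \<open>The family is cut according to its value at the new point \<open>p\<close>; two
    members of one ball of radius \<open>\<delta>/2\<close> differ there by less than
    \<open>\<delta>\<close>.\<close>
  define D where "D z = {i \<in> I. \<Phi> i p \<in> ball z (\<delta>/2)}" for z
  have "\<exists>J\<subseteq>D z. finite J \<and> (\<forall>i\<in>D z. \<exists>j\<in>J. \<forall>p\<in>P. norm (\<Phi> i p - \<Phi> j p) \<le> \<delta>)" for z
    by (rule insert.IH) (use insert.prems in \<open>auto simp: D_def\<close>)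
  then obtain J where J: "\<And>z. J z \<subseteq> D z" "\<And>z. finite (J z)"
    "\<And>z i. i \<in> D z \<Longrightarrow> \<exists>j\<in>J z. \<forall>p\<in>P. norm (\<Phi> i p - \<Phi> j p) \<le> \<delta>" by metis
  have "\<exists>j\<in>(\<Union>z\<in>Z. J z). \<forall>q\<in>insert p P. norm (\<Phi> i q - \<Phi> j q) \<le> \<delta>" if i: "i \<in> I" for i
  proof -
    have "\<Phi> i p \<in> cball 0 C" using insert.prems i by simp
    then obtain z where z: "z \<in> Z" "i \<in> D z" using Z i by (auto simp: D_def)
    then obtain j where j: "j \<in> J z" "\<forall>p\<in>P. norm (\<Phi> i p - \<Phi> j p) \<le> \<delta>" using J by blast
    have "j \<in> D z" using J j by blast
    have "dist (\<Phi> i p) (\<Phi> j p) < \<delta>"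
      by (rule dist_triangle_half_l[of _ z]) (use z \<open>j \<in> D z\<close> in \<open>auto simp: D_def dist_commute\<close>)
    then show ?thesis using j z by (intro bexI[of _ j]) (auto simp: dist_norm)
  qed
  moreover have "(\<Union>z\<in>Z. J z) \<subseteq> I" using J by (auto simp: D_def)
  ultimately show ?case using J Z by (intro exI[of _ "\<Union>z\<in>Z. J z"]) auto
qed

context compact_ab_group
begin

lemma ip_commute:
  assumes [continuous_intros]: "continuous_on UNIV (f :: 'a \<Rightarrow> complex)" "continuous_on UNIV g"
  shows "ip g f = cnj (ip f g)"
proof -
  have "continuous_on UNIV (\<lambda>x. f x * cnj (g x))" by (intro continuous_intros)
  from mean_cnj[OF this] show ?thesis by (simp add: ip_def mult.commute)
qed

lemma ip_add_left:
  assumes [continuous_intros]: "continuous_on UNIV (f :: 'a \<Rightarrow> complex)" "continuous_on UNIV g" "continuous_on UNIV h"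
  shows "ip (\<lambda>x. f x + g x) h = ip f h + ip g h"
proof -
  have "mean (\<lambda>x. f x * cnj (h x) + g x * cnj (h x)) = ip f h + ip g h"
    unfolding ip_def by (intro mean_add continuous_intros)
  then show ?thesis by (simp add: ip_def algebra_simps)
qed

lemma ip_cmult_left:
  assumes [continuous_intros]: "continuous_on UNIV (f :: 'a \<Rightarrow> complex)" "continuous_on UNIV g"
  shows "ip (\<lambda>x. c * f x) g = c * ip f g"
proof -
  have "mean (\<lambda>x. c * (f x * cnj (g x))) = c * ip f g"
    unfolding ip_def by (intro mean_cmult continuous_intros)
  then show ?thesis by (simp add: ip_def algebra_simps)
qed

lemma ip_diff_left:
  assumes [continuous_intros]: "continuous_on UNIV (f :: 'a \<Rightarrow> complex)" "continuous_on UNIV g" "continuous_on UNIV h"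
  shows "ip (\<lambda>x. f x - g x) h = ip f h - ip g h"
proof -
  have "mean (\<lambda>x. f x * cnj (h x) - g x * cnj (h x)) = ip f h - ip g h"
    unfolding ip_def by (intro mean_diff continuous_intros)
  then show ?thesis by (simp add: ip_def algebra_simps)
qed

lemma ip_cmult_right:
  assumes "continuous_on UNIV (f :: 'a \<Rightarrow> complex)" "continuous_on UNIV g"
  shows "ip f (\<lambda>x. c * g x) = cnj c * ip f g"
  using ip_commute[of "\<lambda>x. c * g x" f] ip_commute[of g f] assms
  by (simp add: ip_cmult_left continuous_intros)

lemma ip_diff_right:
  assumes "continuous_on UNIV (f :: 'a \<Rightarrow> complex)" "continuous_on UNIV g" "continuous_on UNIV h"
  shows "ip h (\<lambda>x. f x - g x) = ip h f - ip h g"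
  using ip_commute[of "\<lambda>x. f x - g x" h] ip_commute[of f h] ip_commute[of g h] assms
  by (simp add: ip_diff_left continuous_intros)

lemma ip_add_right:
  assumes "continuous_on UNIV (f :: 'a \<Rightarrow> complex)" "continuous_on UNIV g" "continuous_on UNIV h"
  shows "ip h (\<lambda>x. f x + g x) = ip h f + ip h g"
  using ip_commute[of "\<lambda>x. f x + g x" h] ip_commute[of f h] ip_commute[of g h] assms
  by (simp add: ip_add_left continuous_intros)

lemma ip_sum_left:
  assumes "\<And>i. i \<in> I \<Longrightarrow> continuous_on UNIV (f i :: 'a \<Rightarrow> complex)" "continuous_on UNIV h"
  shows "ip (\<lambda>x. \<Sum>i\<in>I. f i x) h = (\<Sum>i\<in>I. ip (f i) h)"
  unfolding ip_def sum_distrib_right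
  by (intro mean_sum continuous_intros assms)

lemma is_mean_nrm:
  assumes [continuous_intros]: "continuous_on UNIV (f :: 'a \<Rightarrow> complex)"
  shows "is_mean (\<lambda>x. (cmod (f x))\<^sup>2) ((nrm f)\<^sup>2)" "ip f f = of_real ((nrm f)\<^sup>2)"
proof -
  have c: "continuous_on UNIV (\<lambda>x. (cmod (f x))\<^sup>2)" by (intro continuous_intros)
  have eq: "ip f f = mean (\<lambda>x. of_real ((cmod (f x))\<^sup>2))"
    unfolding ip_def by (simp only: complex_norm_square)
  have m: "is_mean (\<lambda>x. (cmod (f x))\<^sup>2) (Re (ip f f))" unfolding eq by (rule mean_real[OF c])
  have "Re (ip f f) \<ge> 0" by (rule is_mean_nonneg[OF m]) auto
  then have r: "(nrm f)\<^sup>2 = Re (ip f f)" by (simp add: nrm_def)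
  show "is_mean (\<lambda>x. (cmod (f x))\<^sup>2) ((nrm f)\<^sup>2)" using m r by simp
  show "ip f f = of_real ((nrm f)\<^sup>2)" using r mean_real(2)[OF c] eq by (simp add: complex_eq_iff)
qed

text \<open>\<open>sqrt\<close> is odd, hence negative on negative arguments, so nonnegativity of
  \<open>Re (ip f f)\<close> has to be supplied.\<close>

lemma nrm_nonneg:
  assumes "continuous_on UNIV (f :: 'a \<Rightarrow> complex)"
  shows "nrm f \<ge> 0"
proof -
  have "complex_of_real ((nrm f)\<^sup>2) = of_real (Re (ip f f))"
    by (subst is_mean_nrm(2)[OF assms])+ simp
  then have "Re (ip f f) = (nrm f)\<^sup>2" by (simp only: of_real_eq_iff)
  then have "nrm f = sqrt ((nrm f)\<^sup>2)" unfolding nrm_def by (rule arg_cong)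
  also have "\<dots> \<ge> 0" by simp
  finally show ?thesis .
qed

lemma nrm_eq_0D:
  assumes [continuous_intros]: "continuous_on UNIV (f :: 'a \<Rightarrow> complex)" and "nrm f = 0"
  shows "f x = 0"
proof -
  have "(cmod (f x))\<^sup>2 = 0"
    by (rule is_mean_zero_imp[where f = "\<lambda>x. (cmod (f x))\<^sup>2"])
       (use is_mean_nrm(1)[OF assms(1)] assms(2) in \<open>auto intro!: continuous_intros\<close>)
  then show ?thesis by simp
qed

lemma nrm_le:
  assumes "continuous_on UNIV (f :: 'a \<Rightarrow> complex)" and "\<And>x. cmod (f x) \<le> C"
  shows "nrm f \<le> C"
proof -
  have "C \<ge> 0" using assms(2)[of 0] norm_ge_zero order_trans by blast
  have "norm ((cmod (f x))\<^sup>2) \<le> C\<^sup>2" for x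
    using power_mono[OF assms(2)[of x], of 2] by simp
  from is_mean_norm_le[OF is_mean_nrm(1)[OF assms(1)] this]
  have "norm ((nrm f)\<^sup>2) \<le> C\<^sup>2" .
  then have "(nrm f)\<^sup>2 \<le> C\<^sup>2" by simp
  then show ?thesis using \<open>C \<ge> 0\<close> by (rule power2_le_imp_le)
qed

lemma nrm_cmult:
  assumes "continuous_on UNIV (f :: 'a \<Rightarrow> complex)"
  shows "nrm (\<lambda>x. c * f x) = cmod c * nrm f"
proof -
  have "ip (\<lambda>x. c * f x) (\<lambda>x. c * f x) = c * cnj c * ip f f"
    using assms by (simp add: ip_cmult_left ip_cmult_right continuous_intros)
  also have "\<dots> = of_real ((cmod c * nrm f)\<^sup>2)"
    by (simp add: is_mean_nrm(2)[OF assms] complex_norm_square[symmetric] power_mult_distrib)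
  finally show ?thesis using nrm_nonneg[OF assms]
    by (simp add: nrm_def)
qed

lemma cauchy_schwarz:
  assumes c [continuous_intros]: "continuous_on UNIV (f :: 'a \<Rightarrow> complex)" "continuous_on UNIV g"
  shows "cmod (ip f g) \<le> nrm f * nrm g"
proof (cases "nrm g = 0")
  case True
  then have "g = (\<lambda>_. 0)" using nrm_eq_0D[OF c(2)] by blast
  then have "ip f g = 0" by (simp add: ip_def mean_const)
  then show ?thesis using True by simp
next
  case False
  define a where "a = ip f g"
  define B where "B = (nrm g)\<^sup>2"
  have B: "B > 0" using False by (simp add: B_def)
  have ch: "continuous_on UNIV (\<lambda>x. (a / B) * g x)" by (intro continuous_intros)
  have "ip g f = cnj a" using ip_commute[OF c] by (simp add: a_def)
  \<comment> \<open>\<open>a / B * g\<close> is the orthogonal projection of \<open>f\<close> onto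
    \<open>g\<close>; the inequality says that the squared norm of the residual is
    nonnegative.\<close>
  then have "ip (\<lambda>x. f x - a / B * g x) (\<lambda>x. f x - a / B * g x) = of_real ((nrm f)\<^sup>2 - (cmod a)\<^sup>2 / B)"
    using B unfolding ip_diff_left[OF c(1) ch continuous_on_diff[OF c(1) ch]]
     ip_diff_right[OF c(1) ch c(1)] ip_diff_right[OF c(1) ch ch]
     ip_cmult_left[OF c(2) c(1)] ip_cmult_left[OF c(2) ch] ip_cmult_right[OF c(1,2)] ip_cmult_right[OF c(2,2)]
     is_mean_nrm(2)[OF c(1)] is_mean_nrm(2)[OF c(2)] a_def[symmetric] B_def[symmetric] of_real_diff
     of_real_divide complex_norm_square[of a]
    by (simp add: field_simps)
  then have "of_real ((nrm (\<lambda>x. f x - a / B * g x))\<^sup>2) = complex_of_real ((nrm f)\<^sup>2 - (cmod a)\<^sup>2 / B)"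
    using is_mean_nrm(2)[OF continuous_on_diff[OF c(1) ch]] by (rule trans[OF sym, rotated])
  then have "(nrm f)\<^sup>2 - (cmod a)\<^sup>2 / B \<ge> 0"
    unfolding of_real_eq_iff by (metis zero_le_power2)
  then have "(cmod a)\<^sup>2 \<le> (nrm f * nrm g)\<^sup>2" using B by (simp add: field_simps B_def)
  then show ?thesis unfolding a_def
    by (rule power2_le_imp_le) (simp add: nrm_nonneg c)
qed

lemma nrm_add_le:
  assumes c [continuous_intros]: "continuous_on UNIV (f :: 'a \<Rightarrow> complex)" "continuous_on UNIV g"
  shows "nrm (\<lambda>x. f x + g x) \<le> nrm f + nrm g"
proof -
  have cc: "continuous_on UNIV (\<lambda>x. f x + g x)" by (intro continuous_intros)
  have "of_real ((nrm (\<lambda>x. f x + g x))\<^sup>2) = ip f f + ip f g + cnj (ip f g) + ip g g"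
    unfolding is_mean_nrm(2)[OF cc, symmetric]
    by (simp add: ip_add_left[OF c cc] ip_add_right[OF c c(1)] ip_add_right[OF c c(2)] ip_commute[OF c])
  also have "\<dots> = of_real ((nrm f)\<^sup>2 + 2 * Re (ip f g) + (nrm g)\<^sup>2)"
    unfolding is_mean_nrm(2)[OF c(1)] is_mean_nrm(2)[OF c(2)] by (simp add: complex_eq_iff)
  finally have "(nrm (\<lambda>x. f x + g x))\<^sup>2 = (nrm f)\<^sup>2 + 2 * Re (ip f g) + (nrm g)\<^sup>2"
    by (simp only: of_real_eq_iff)
  also have "\<dots> \<le> (nrm f)\<^sup>2 + 2 * (nrm f * nrm g) + (nrm g)\<^sup>2"
    using cauchy_schwarz[OF c] complex_Re_le_cmod[of "ip f g"] by simp
  also have "\<dots> = (nrm f + nrm g)\<^sup>2" by (simp add: power2_eq_square algebra_simps)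
  finally show ?thesis
    by (rule power2_le_imp_le) (simp add: nrm_nonneg c)
qed

lemma nrm_diff_le:
  assumes c: "continuous_on UNIV (f :: 'a \<Rightarrow> complex)" "continuous_on UNIV g"
  shows "\<bar>nrm f - nrm g\<bar> \<le> nrm (\<lambda>x. f x - g x)"
proof -
  have d: "continuous_on UNIV (\<lambda>x. f x - g x)" "continuous_on UNIV (\<lambda>x. g x - f x)"
    by (intro continuous_intros c)+
  have "nrm (\<lambda>x. g x - f x) = nrm (\<lambda>x. f x - g x)"
    using nrm_cmult[OF d(1), of "-1"] by simp
  then show ?thesis
    using nrm_add_le[OF d(1) c(2)] nrm_add_le[OF d(2) c(1)] by simp
qed

text \<open>The sequence is totally bounded for the uniform metric, which yields a Cauchy
  subsequence: equicontinuity reduces uniform closeness to closeness at finitely many points, where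
  \<open>finite_net\<close> applies.\<close>

lemma arzela_ascoli:
  fixes f :: "nat \<Rightarrow> 'a \<Rightarrow> complex"
  assumes cont: "\<And>n. continuous_on UNIV (f n)" and bdd: "\<And>n x. cmod (f n x) \<le> C"
    and equi: "\<And>e. e > 0 \<Longrightarrow> \<exists>V. open V \<and> 0 \<in> V \<and> (\<forall>n x. \<forall>v\<in>V. cmod (f n (x + v) - f n x) \<le> e)"
  obtains r g where "strict_mono r" "continuous_on UNIV g" "uniform_limit UNIV (\<lambda>n. f (r n)) g sequentially"
proof -
  define F where "F n = Bcontfun (f n)" for n
  have F: "apply_bcontfun (F n) = f n" for n
    unfolding F_def by (rule Bcontfun_inverse) (use cont bdd in \<open>auto simp: bcontfun_def bounded_iff\<close>)
  have "\<exists>K. finite K \<and> K \<subseteq> range F \<and> range F \<subseteq> (\<Union>x\<in>K. Met_TC.mball x e)" if e: "e > 0" for e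
  proof -
    obtain V where V: "open V" "0 \<in> V" "\<And>n x v. v \<in> V \<Longrightarrow> cmod (f n (x + v) - f n x) \<le> e / 8"
      using equi[of "e/8"] e by auto
    obtain ps where ps: "\<And>x. \<exists>p\<in>set ps. x + p \<in> V"
      using finite_translates_cover[of V] V by blast
    \<comment> \<open>The sample points are \<open>- p\<close>: if \<open>x + p\<close> lies in
      \<open>V\<close>, then \<open>x\<close> lies in \<open>- p + V\<close>, where equicontinuity
      compares \<open>x\<close> with \<open>- p\<close>.\<close>
    have "\<exists>J\<subseteq>UNIV. finite J \<and> (\<forall>i\<in>UNIV. \<exists>j\<in>J. \<forall>p\<in>uminus ` set ps. norm (f i p - f j p) \<le> e / 8)"
      by (rule finite_net) (use bdd e in auto)
    then obtain J where J: "finite J" "\<And>i. \<exists>j\<in>J. \<forall>p\<in>uminus ` set ps. norm (f i p - f j p) \<le> e / 8"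
      by auto
    have "range F \<subseteq> (\<Union>j\<in>J. ball (F j) e)"
    proof safe
      fix n
      obtain j where j: "j \<in> J" "\<And>p. p \<in> set ps \<Longrightarrow> norm (f n (- p) - f j (- p)) \<le> e / 8"
        using J(2)[of n] by blast
      have "dist (f j x) (f n x) \<le> e / 2" for x
      proof -
        obtain p where p: "p \<in> set ps" "x + p \<in> V" using ps by blast
        have eq: "- p + (x + p) = x" by simp
        have "f n x - f j x = (f n x - f n (- p)) + ((f n (- p) - f j (- p)) - (f j x - f j (- p)))" by simp
        also have "norm \<dots> \<le> e/8 + (e/8 + e/8)"
          by (intro norm_triangle_mono order_trans[OF norm_triangle_ineq4 add_mono] j(2)[OF p(1)]
               V(3)[OF p(2), of _ "- p", unfolded eq])
        finally show ?thesis using e by (simp add: dist_norm norm_minus_commute)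
      qed
      then have "dist (F j) (F n) \<le> e / 2" by (intro dist_bound) (simp add: F)
      then show "F n \<in> (\<Union>j\<in>J. ball (F j) e)" using j e by (intro UN_I[of j]) auto
    qed
    then show ?thesis using J(1) by (intro exI[of _ "F ` J"]) auto
  qed
  then have "Met_TC.mtotally_bounded (range F)"
    unfolding Met_TC.mtotally_bounded_def by blast
  then obtain r where r: "strict_mono r" "Cauchy (F \<circ> r)"
    unfolding Met_TC.mtotally_bounded_sequentially MCauchy_iff_Cauchy by blast
  have "uniformly_Cauchy_on UNIV (\<lambda>n. f (r n))"
    unfolding uniformly_Cauchy_on_def
  proof (intro allI impI)
    fix e :: real assume "e > 0"
    then obtain N where N: "\<And>m n. m \<ge> N \<Longrightarrow> n \<ge> N \<Longrightarrow> dist (F (r m)) (F (r n)) < e"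
      using r(2) unfolding Cauchy_def comp_def by blast
    have "dist (f (r m) x) (f (r n) x) < e" if "m \<ge> N" "n \<ge> N" for m n x
      using dist_bounded[of "F (r m)" x "F (r n)"] N[OF that] by (simp add: F)
    then show "\<exists>M. \<forall>x\<in>UNIV. \<forall>m\<ge>M. \<forall>n\<ge>M. dist (f (r m) x) (f (r n) x) < e" by blast
  qed
  then obtain g where g: "uniform_limit UNIV (\<lambda>n. f (r n)) g sequentially"
    using Cauchy_uniformly_convergent uniformly_convergent_on_def by blast
  have "continuous_on UNIV g"
    by (rule uniform_limit_theorem[OF _ g]) (use cont in auto)
  with g r(1) show ?thesis by (rule that[rotated 2])
qed

end

section \<open>Convolution operators\<close>

definition conv :: "('b::ab_group_add \<Rightarrow> complex) \<Rightarrow> ('b \<Rightarrow> complex) \<Rightarrow> 'b \<Rightarrow> complex" where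
  "conv k u x = mean (\<lambda>y. k (x - y) * u y)"

text \<open>\<open>k_herm\<close> makes convolution self-adjoint for \<open>ip\<close>;
  \<open>K\<close> bounds it as an operator from the norm \<open>nrm\<close> to the sup
  norm.\<close>

locale hermitian_kernel = compact_ab_group G for G :: "'a::topological_ab_group_add itself" +
  fixes k :: "'a \<Rightarrow> complex" and K :: real
  assumes k_cont: "continuous_on UNIV k"
    and k_herm: "\<And>x. k (- x) = cnj (k x)"
    and k_bdd: "\<And>x. cmod (k x) \<le> K"
begin

lemma k_diff_cont: "continuous_on UNIV (\<lambda>y. k (x - y))"
  by (intro continuous_on_compose2[OF k_cont] continuous_intros) auto

lemma K_nonneg: "K \<ge> 0"
  using k_bdd[of 0] norm_ge_zero order_trans by blast

lemma kernel_cont: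
  assumes u: "continuous_on UNIV u"
  shows "continuous_on UNIV (\<lambda>z. k (fst z - snd z) * u (snd z))"
  by (intro continuous_intros continuous_on_compose2[OF k_cont] continuous_on_compose2[OF u]) auto

lemma conv_cont [continuous_intros]: "continuous_on UNIV u \<Longrightarrow> continuous_on UNIV (conv k u)"
  using continuous_mean[OF kernel_cont] by (simp add: conv_def[abs_def])

lemma conv_add:
  assumes u [continuous_intros]: "continuous_on UNIV u" "continuous_on UNIV v"
  shows "conv k (\<lambda>x. u x + v x) = (\<lambda>x. conv k u x + conv k v x)"
proof
  fix x
  note k_diff_cont[of x, continuous_intros]
  show "conv k (\<lambda>x. u x + v x) x = conv k u x + conv k v x"
    unfolding conv_def distrib_left by (rule mean_add) (intro continuous_intros)+
qed

lemma conv_diff: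
  assumes u [continuous_intros]: "continuous_on UNIV u" "continuous_on UNIV v"
  shows "conv k (\<lambda>x. u x - v x) = (\<lambda>x. conv k u x - conv k v x)"
proof
  fix x
  note k_diff_cont[of x, continuous_intros]
  show "conv k (\<lambda>x. u x - v x) x = conv k u x - conv k v x"
    unfolding conv_def right_diff_distrib by (rule mean_diff) (intro continuous_intros)+
qed

lemma conv_cmult:
  assumes u [continuous_intros]: "continuous_on UNIV u"
  shows "conv k (\<lambda>x. c * u x) = (\<lambda>x. c * conv k u x)"
proof
  fix x
  note k_diff_cont[of x, continuous_intros]
  have "mean (\<lambda>y. c * (k (x - y) * u y)) = c * conv k u x"
    unfolding conv_def by (rule mean_cmult) (intro continuous_intros)+
  then show "conv k (\<lambda>x. c * u x) x = c * conv k u x"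
    by (simp add: conv_def algebra_simps)
qed

lemma conv_translate:
  assumes u: "continuous_on UNIV u"
  shows "conv k (\<lambda>x. u (x + a)) = (\<lambda>x. conv k u (x + a))"
proof
  fix x
  have c: "continuous_on UNIV (\<lambda>y. k (x + a - y) * u y)"
    by (intro continuous_intros k_diff_cont u)
  show "conv k (\<lambda>x. u (x + a)) x = conv k u (x + a)"
    using mean_translate[OF c, of a] by (simp add: conv_def)
qed

text \<open>Cauchy-Schwarz against \<open>cnj f\<close>: a pointwise bound on the kernel turns
  control in \<open>nrm\<close> into control at every point.\<close>

lemma conv_bound_gen:
  assumes u: "continuous_on UNIV (u :: 'a \<Rightarrow> complex)" and f: "continuous_on UNIV f" "\<And>y. cmod (f y) \<le> C"
  shows "cmod (mean (\<lambda>y. f y * u y)) \<le> C * nrm u"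
proof -
  have c: "continuous_on UNIV (\<lambda>y. cnj (f y))" by (intro continuous_intros f)
  have "mean (\<lambda>y. f y * u y) = ip u (\<lambda>y. cnj (f y))"
    by (simp add: ip_def mult.commute)
  also have "cmod \<dots> \<le> nrm u * nrm (\<lambda>y. cnj (f y))" by (rule cauchy_schwarz[OF u c])
  also have "\<dots> \<le> nrm u * C" by (intro mult_left_mono nrm_le c nrm_nonneg u) (use f in auto)
  finally show ?thesis by (simp add: mult.commute)
qed

lemma conv_bound: "continuous_on UNIV u \<Longrightarrow> cmod (conv k u x) \<le> K * nrm u"
  unfolding conv_def by (intro conv_bound_gen k_diff_cont k_bdd)

lemma nrm_conv_le: "continuous_on UNIV u \<Longrightarrow> nrm (conv k u) \<le> K * nrm u"
  by (intro nrm_le conv_bound conv_cont)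

text \<open>The modulus of continuity depends on \<open>u\<close> only through \<open>nrm u\<close>,
  so the image of the unit ball is equicontinuous; this is the source of the compactness of the
  operator.\<close>

lemma conv_equicont:
  assumes "e > 0"
  shows "\<exists>V. open V \<and> 0 \<in> V \<and> (\<forall>u x. \<forall>v\<in>V. continuous_on UNIV u \<longrightarrow>
     cmod (conv k u (x + v) - conv k u x) \<le> e * nrm u)"
proof -
  obtain V where V: "open V" "0 \<in> V" "\<And>x v. v \<in> V \<Longrightarrow> dist (k (x + v)) (k x) \<le> e"
    using unif_cont[OF k_cont assms] by blast
  have "cmod (conv k u (x + v) - conv k u x) \<le> e * nrm u"
    if v: "v \<in> V" and u: "continuous_on UNIV u" for u x v
  proof -
    have "conv k u (x + v) - conv k u x = mean (\<lambda>y. k (x + v - y) * u y - k (x - y) * u y)"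
      unfolding conv_def by (rule mean_diff[symmetric]) (intro continuous_intros k_diff_cont u)+
    also have "\<dots> = mean (\<lambda>y. (k (x + v - y) - k (x - y)) * u y)" by (simp add: algebra_simps)
    also have "cmod \<dots> \<le> e * nrm u"
    proof (rule conv_bound_gen[OF u])
      show "continuous_on UNIV (\<lambda>y. k (x + v - y) - k (x - y))" by (intro continuous_intros k_diff_cont)
      have eq: "x + v - y = (x - y) + v" for y by simp
      show "cmod (k (x + v - y) - k (x - y)) \<le> e" for y
        using V(3)[OF v, of "x - y"] unfolding eq by (simp add: dist_norm)
    qed
    finally show ?thesis .
  qed
  then show ?thesis using V by blast
qed

text \<open>\<open>mean_swap\<close> exchanges the two means, and \<open>k_herm\<close> turns
  \<open>k (x - y)\<close> into \<open>cnj (k (y - x))\<close>.\<close>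

lemma conv_adjoint:
  assumes u [continuous_intros]: "continuous_on UNIV u" "continuous_on UNIV v"
  shows "ip (conv k u) v = ip u (conv k v)"
proof -
  note k_diff_cont[continuous_intros]
  have k_diff_cont' [continuous_intros]: "continuous_on UNIV (\<lambda>x. k (x - y))" for y
    by (intro continuous_on_compose2[OF k_cont] continuous_intros) auto
  define F where "F z = k (fst z - snd z) * u (snd z) * cnj (v (fst z))" for z
  have F: "continuous_on UNIV F" unfolding F_def
    by (intro continuous_intros kernel_cont continuous_on_compose2[OF u(2)]) (auto intro: u)
  have "ip (conv k u) v = mean (\<lambda>x. mean (\<lambda>y. F (x, y)))"
  proof -
    have "mean (\<lambda>y. F (x, y)) = conv k u x * cnj (v x)" for x
      unfolding F_def fst_conv snd_conv conv_def by (rule mean_cmult) (intro continuous_intros)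
    then show ?thesis by (simp add: ip_def)
  qed
  also have "\<dots> = mean (\<lambda>y. mean (\<lambda>x. F (x, y)))" by (rule mean_swap[OF F])
  also have "\<dots> = ip u (conv k v)"
  proof -
    have "mean (\<lambda>x. F (x, y)) = u y * cnj (conv k v y)" for y
    proof -
      have c: "continuous_on UNIV (\<lambda>x. k (y - x) * v x)" by (intro continuous_intros)
      have "F (x, y) = u y * cnj (k (y - x) * v x)" for x
        using k_herm[of "y - x"] by (simp add: F_def)
      then have "mean (\<lambda>x. F (x, y)) = mean (\<lambda>x. u y * cnj (k (y - x) * v x))" by simp
      also have "\<dots> = u y * mean (\<lambda>x. cnj (k (y - x) * v x))"
        by (rule mean_cmult) (intro continuous_intros)
      also have "\<dots> = u y * cnj (conv k v y)" unfolding conv_def mean_cnj[OF c] ..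
      finally show ?thesis .
    qed
    then show ?thesis by (simp add: ip_def)
  qed
  finally show ?thesis .
qed

text \<open>With \<open>L\<close> the operator norm and unit vectors \<open>v n\<close> almost attaining it,
  \<open>conv k (conv k (v n)) - L\<^sup>2 v n\<close> tends to zero in norm; a uniform limit \<open>w\<close> of a
  subsequence of \<open>conv k (v n)\<close> is therefore an eigenfunction.\<close>

theorem eigenfunction_exists:
  assumes u0: "continuous_on UNIV u0" "conv k u0 x0 \<noteq> 0"
  obtains \<mu> w where "\<mu> > 0" "continuous_on UNIV w" "\<exists>x. w x \<noteq> 0"
    "conv k (conv k w) = (\<lambda>x. of_real \<mu> * w x)"
proof -
  define N where "N = {nrm (conv k v) |v. continuous_on UNIV v \<and> nrm v \<le> 1}"
  define L where "L = Sup N"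
  have bddN: "bdd_above N"
  proof (rule bdd_aboveI)
    fix r assume "r \<in> N"
    then obtain v where v: "r = nrm (conv k v)" "continuous_on UNIV v" "nrm v \<le> 1" by (auto simp: N_def)
    then show "r \<le> K" using nrm_conv_le[of v] mult_left_mono[OF v(3) K_nonneg] by simp
  qed
  have unit: "nrm (conv k v) \<le> L" if "continuous_on UNIV v" "nrm v \<le> 1" for v
    unfolding L_def by (intro cSup_upper bddN) (use that in \<open>auto simp: N_def\<close>)
  have zero: "nrm v \<noteq> 0" if "continuous_on UNIV v" "conv k v x \<noteq> 0" for v x
    using conv_bound[OF that(1), of x] that by auto
  have bound: "nrm (conv k v) \<le> L * nrm v" if v: "continuous_on UNIV v" for v
  proof (cases "nrm v = 0")
    case True
    then show ?thesis using nrm_conv_le[OF v] by simp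
  next
    case False
    then have pos: "nrm v > 0" using nrm_nonneg[OF v] by simp
    define c where "c = complex_of_real (inverse (nrm v))"
    have "nrm (conv k (\<lambda>x. c * v x)) \<le> L"
      by (rule unit) (use pos in \<open>auto simp: nrm_cmult[OF v] c_def norm_inverse intro!: continuous_intros v\<close>)
    then have "cmod c * nrm (conv k v) \<le> L"
      unfolding conv_cmult[OF v] by (simp add: nrm_cmult conv_cont v)
    moreover have "cmod c = inverse (nrm v)" unfolding c_def norm_of_real using pos by simp
    ultimately show ?thesis using pos by (simp add: field_simps)
  qed
  \<comment> \<open>\<open>u0\<close> witnesses that the operator is nonzero, which gives
    \<open>L > 0\<close>.\<close>
  have "nrm (conv k u0) \<noteq> 0" using nrm_eq_0D[OF conv_cont[OF u0(1)]] u0(2) by blast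
  then have "0 < L * nrm u0" using bound[OF u0(1)] nrm_nonneg[OF conv_cont[OF u0(1)]] by simp
  then have L: "L > 0" using nrm_nonneg[OF u0(1)] by (simp add: zero_less_mult_iff)
  have nrm0: "nrm (\<lambda>_::'a. 0) = 0" by (simp add: nrm_def ip_def mean_const)
  have "\<exists>v. continuous_on UNIV v \<and> nrm v \<le> 1 \<and> nrm (conv k v) > L - 1 / real (Suc n)" for n
  proof -
    from nrm0 have "N \<noteq> {}" unfolding N_def by (auto intro!: exI[of _ "\<lambda>_. 0"])
    moreover have "L - 1 / real (Suc n) < Sup N" by (simp add: L_def)
    ultimately show ?thesis using less_cSup_iff[OF _ bddN] by (auto simp: N_def)
  qed
  then obtain V where V: "\<And>n. continuous_on UNIV (V n)" "\<And>n. nrm (V n) \<le> 1"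
    "\<And>n. nrm (conv k (V n)) > L - 1 / real (Suc n)" by metis
  obtain r w where r: "strict_mono r" and w: "continuous_on UNIV w"
    and lim: "uniform_limit UNIV (\<lambda>n. conv k (V (r n))) w sequentially"
  proof (rule arzela_ascoli[of "\<lambda>n. conv k (V n)" K])
    show "continuous_on UNIV (conv k (V n))" for n by (intro conv_cont V)
    show "cmod (conv k (V n) x) \<le> K" for n x
      using conv_bound[OF V(1), of n x] mult_left_mono[OF V(2)[of n] K_nonneg] by simp
    fix e :: real assume e: "e > 0"
    then obtain W where W: "open W" "0 \<in> W" "\<And>u x v. v \<in> W \<Longrightarrow> continuous_on UNIV u \<Longrightarrow>
       cmod (conv k u (x + v) - conv k u x) \<le> e * nrm u"
      using conv_equicont[of e] by metis
    have "cmod (conv k (V n) (x + v) - conv k (V n) x) \<le> e" if "v \<in> W" for n x v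
    proof -
      have "e * nrm (V n) \<le> e" using V(2)[of n] e by simp
      then show ?thesis using W(3)[OF that V(1), of n x] by linarith
    qed
    then show "\<exists>V'. open V' \<and> 0 \<in> V' \<and> (\<forall>n x. \<forall>v\<in>V'. cmod (conv k (V n) (x + v) - conv k (V n) x) \<le> e)"
      using W(1,2) by blast
  qed
  define v where "v n = V (r n)" for n
  define z where "z n = conv k (v n)" for n
  have v: "continuous_on UNIV (v n)" "nrm (v n) \<le> 1" for n by (auto simp: v_def V)
  have z: "continuous_on UNIV (z n)" for n unfolding z_def by (intro conv_cont v)
  define d where "d n = nrm (\<lambda>x. z n x - w x)" for n
  have dcont: "continuous_on UNIV (\<lambda>x. z n x - w x)" for n by (intro continuous_intros z w)
  have d: "d \<longlonglongrightarrow> 0"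
  proof (rule tendstoI)
    fix e :: real assume "e > 0"
    then have "\<forall>\<^sub>F n in sequentially. \<forall>x\<in>UNIV. dist (z n x) (w x) < e / 2"
      using uniform_limitD[OF lim, of "e/2"] by (simp add: z_def v_def)
    then show "\<forall>\<^sub>F n in sequentially. dist (d n) 0 < e"
    proof (rule eventually_mono)
      fix n assume "\<forall>x\<in>UNIV. dist (z n x) (w x) < e / 2"
      then have "d n \<le> e / 2" unfolding d_def by (intro nrm_le dcont) (auto simp: dist_norm less_imp_le)
      then show "dist (d n) 0 < e" using nrm_nonneg[OF dcont[of n]] \<open>e > 0\<close> by (simp add: d_def)
    qed
  qed
  have nz: "(\<lambda>n. nrm (z n)) \<longlonglongrightarrow> L"
  proof (rule tendsto_sandwich[of "\<lambda>n. L - 1 / real (Suc (r n))" _ _ "\<lambda>_. L"])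
    show "\<forall>\<^sub>F n in sequentially. L - 1 / real (Suc (r n)) \<le> nrm (z n)"
      using V(3) by (auto simp: z_def v_def less_imp_le)
    show "\<forall>\<^sub>F n in sequentially. nrm (z n) \<le> L" using unit v by (simp add: z_def)
    have "(\<lambda>n. 1 / real (Suc n)) \<longlonglongrightarrow> 0" using LIMSEQ_inverse_real_of_nat by (simp add: inverse_eq_divide)
    from LIMSEQ_subseq_LIMSEQ[OF this r] have "(\<lambda>n. 1 / real (Suc (r n))) \<longlonglongrightarrow> 0" by (simp add: comp_def)
    from tendsto_diff[OF tendsto_const this] show "(\<lambda>n. L - 1 / real (Suc (r n))) \<longlonglongrightarrow> L" by simp
  qed auto
  have "(\<lambda>n. nrm (z n) - nrm w) \<longlonglongrightarrow> 0"
    by (rule tendsto_rabs_zero_cancel, rule tendsto_sandwich[OF _ _ tendsto_const d])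
       (use nrm_diff_le[OF z w] in \<open>auto simp: d_def\<close>)
  then have "(\<lambda>n. nrm (z n)) \<longlonglongrightarrow> nrm w" by (rule LIM_zero_cancel)
  from LIMSEQ_unique[OF this nz] have "nrm w = L" .
  \<comment> \<open>The limit keeps norm \<open>L > 0\<close>, so it is not the zero
    function.\<close>
  then have wx: "\<exists>x. w x \<noteq> 0" using nrm0 L by (metis ext less_irrefl)
  define y where "y n x = conv k (conv k (v n)) x - of_real (L\<^sup>2) * v n x" for n x
  have yc: "continuous_on UNIV (y n)" for n unfolding y_def by (intro continuous_intros v)
  \<comment> \<open>The square is expanded with self-adjointness;
    \<open>nrm (conv k (z n)) \<le> L * nrm (z n)\<close> and \<open>nrm (v n) \<le> 1\<close> leave
    only this defect, which tends to 0 as \<open>nrm (z n)\<close> tends to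
    \<open>L\<close>.\<close>
  have ny: "(nrm (y n))\<^sup>2 \<le> L\<^sup>2 * (L\<^sup>2 - (nrm (z n))\<^sup>2)" for n
  proof -
    have cz: "continuous_on UNIV (conv k (z n))" by (intro conv_cont z)
    have cv: "continuous_on UNIV (\<lambda>x. of_real (L\<^sup>2) * v n x)" by (intro continuous_intros v)
    have y': "y n = (\<lambda>x. conv k (z n) x - of_real (L\<^sup>2) * v n x)" by (simp add: y_def z_def fun_eq_iff)
    have a: "ip (conv k (z n)) (v n) = of_real ((nrm (z n))\<^sup>2)"
      unfolding conv_adjoint[OF z v(1)] z_def[symmetric] by (rule is_mean_nrm(2)[OF z])
    have b: "ip (v n) (conv k (z n)) = of_real ((nrm (z n))\<^sup>2)"
      using ip_commute[OF cz v(1)] a by simp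
    have "of_real ((nrm (y n))\<^sup>2) = ip (y n) (y n)" by (rule is_mean_nrm(2)[OF yc, symmetric])
    also have "\<dots> = of_real ((nrm (conv k (z n)))\<^sup>2) - 2 * of_real (L\<^sup>2) * of_real ((nrm (z n))\<^sup>2)
         + of_real (L\<^sup>2) * of_real (L\<^sup>2) * of_real ((nrm (v n))\<^sup>2)"
      unfolding y' ip_diff_left[OF cz cv continuous_on_diff[OF cz cv]] ip_diff_right[OF cz cv cz]
        ip_diff_right[OF cz cv cv] ip_cmult_left[OF v(1) cz] ip_cmult_left[OF v(1) cv]
        ip_cmult_right[OF cz v(1)] ip_cmult_right[OF v(1) v(1)] a b
        is_mean_nrm(2)[OF cz] is_mean_nrm(2)[OF v(1)]
      by (simp add: algebra_simps)
    also have "\<dots> = of_real ((nrm (conv k (z n)))\<^sup>2 - 2 * L\<^sup>2 * (nrm (z n))\<^sup>2 + L\<^sup>2 * L\<^sup>2 * (nrm (v n))\<^sup>2)"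
      by simp
    finally have "(nrm (y n))\<^sup>2 = (nrm (conv k (z n)))\<^sup>2 - 2 * L\<^sup>2 * (nrm (z n))\<^sup>2 + L\<^sup>2 * L\<^sup>2 * (nrm (v n))\<^sup>2"
      unfolding of_real_eq_iff .
    moreover have "(nrm (conv k (z n)))\<^sup>2 \<le> L\<^sup>2 * (nrm (z n))\<^sup>2"
      using power_mono[OF bound[OF z[of n]] nrm_nonneg[OF cz], of 2] by (simp add: power_mult_distrib)
    moreover have "L\<^sup>2 * L\<^sup>2 * (nrm (v n))\<^sup>2 \<le> L\<^sup>2 * L\<^sup>2 * 1"
      using power_mono[OF v(2)[of n] nrm_nonneg[OF v(1)[of n]], of 2] by (intro mult_left_mono) auto
    ultimately show ?thesis by (simp add: algebra_simps)
  qed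
  have ny0: "(\<lambda>n. nrm (y n)) \<longlonglongrightarrow> 0"
  proof -
    have "(\<lambda>n. L\<^sup>2 * (L\<^sup>2 - (nrm (z n))\<^sup>2)) \<longlonglongrightarrow> L\<^sup>2 * (L\<^sup>2 - L\<^sup>2)" by (intro tendsto_intros nz)
    then have "(\<lambda>n. L\<^sup>2 * (L\<^sup>2 - (nrm (z n))\<^sup>2)) \<longlonglongrightarrow> 0" by simp
    then have "(\<lambda>n. (nrm (y n))\<^sup>2) \<longlonglongrightarrow> 0"
      by (rule tendsto_sandwich[rotated 2, OF tendsto_const]) (use ny in auto)
    from tendsto_real_sqrt[OF this] show ?thesis using nrm_nonneg[OF yc] by simp
  qed
  have "conv k (conv k w) x = of_real (L\<^sup>2) * w x" for x
  proof -
    have 1: "(\<lambda>n. conv k (y n) x) \<longlonglongrightarrow> 0"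
      by (rule Lim_null_comparison[OF always_eventually tendsto_mult_right_zero[OF ny0, of K]])
         (use conv_bound[OF yc] in auto)
    have 2: "(\<lambda>n. conv k (conv k (\<lambda>x. z n x - w x)) x) \<longlonglongrightarrow> 0"
    proof (rule Lim_null_comparison[OF always_eventually tendsto_mult_right_zero[OF d, of "K * K"]], rule)
      fix n
      have "cmod (conv k (conv k (\<lambda>x. z n x - w x)) x) \<le> K * nrm (conv k (\<lambda>x. z n x - w x))"
        by (intro conv_bound conv_cont dcont)
      also have "\<dots> \<le> K * (K * d n)" unfolding d_def by (intro mult_left_mono nrm_conv_le dcont K_nonneg)
      finally show "cmod (conv k (conv k (\<lambda>x. z n x - w x)) x) \<le> K * K * d n" by simp
    qed
    have 3: "(\<lambda>n. z n x - w x) \<longlonglongrightarrow> 0"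
      using tendsto_uniform_limitI[OF lim UNIV_I, of x] by (intro LIM_zero) (simp add: z_def v_def)
    \<comment> \<open>\<open>v n\<close> need not converge, so the operator is applied once more to
      \<open>y n\<close>: the result involves only \<open>z n = conv k (v n)\<close>, which
      converges to \<open>w\<close>.\<close>
    have eq: "conv k (y n) x = conv k (conv k (\<lambda>x. z n x - w x)) x - of_real (L\<^sup>2) * (z n x - w x)
        + (conv k (conv k w) x - of_real (L\<^sup>2) * w x)" for n
    proof -
      have "conv k (y n) = (\<lambda>x. conv k (conv k (z n)) x - of_real (L\<^sup>2) * z n x)"
        unfolding y_def z_def
        by (simp add: conv_diff conv_cmult conv_cont v continuous_on_mult_left)
      then show ?thesis by (simp add: conv_diff conv_cont z w algebra_simps)
    qed
    have "(\<lambda>n. conv k (y n) x) \<longlonglongrightarrow> 0 - of_real (L\<^sup>2) * 0 + (conv k (conv k w) x - of_real (L\<^sup>2) * w x)"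
      unfolding eq by (intro tendsto_intros 2 3)
    from LIMSEQ_unique[OF this 1] show ?thesis by simp
  qed
  then have "conv k (conv k w) = (\<lambda>x. of_real (L\<^sup>2) * w x)" by (rule ext)
  with that[of "L\<^sup>2" w] L w wx show ?thesis by simp
qed

end

section \<open>Finite-dimensional translation-invariant spaces\<close>

text \<open>Scalars are complex, so that span, independence and \<open>cfun.dim\<close> are complex
  notions and shifts on finite-dimensional invariant spaces have eigenvalues.\<close>

definition cscale :: "complex \<Rightarrow> ('b \<Rightarrow> complex) \<Rightarrow> 'b \<Rightarrow> complex" where
  "cscale c f = (\<lambda>x. c * f x)"

interpretation cfun: vector_space "cscale :: complex \<Rightarrow> ('b \<Rightarrow> complex) \<Rightarrow> 'b \<Rightarrow> complex"
  by standard (auto simp: cscale_def fun_eq_iff algebra_simps)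

definition shift :: "'b::ab_group_add \<Rightarrow> ('b \<Rightarrow> complex) \<Rightarrow> 'b \<Rightarrow> complex" where
  "shift y f = (\<lambda>x. f (x + y))"

lemma shift_add: "shift y (f + g) = shift y f + shift y g"
  by (simp add: shift_def fun_eq_iff)

lemma shift_cscale: "shift y (cscale c f) = cscale c (shift y f)"
  by (simp add: shift_def cscale_def)

lemma shift_commute: "shift y (shift z f) = shift z (shift y f)"
  by (simp add: shift_def fun_eq_iff algebra_simps)

lemma shift_sum: "shift y (sum f I) = (\<Sum>i\<in>I. shift y (f i))"
  by (induction I rule: infinite_finite_induct) (auto simp: shift_add, auto simp: shift_def fun_eq_iff)

text \<open>The operator \<open>p(T)\<close> for \<open>T = shift y\<close>, applied to
  \<open>f\<close>.\<close>

definition poly_shift :: "complex poly \<Rightarrow> 'b::ab_group_add \<Rightarrow> ('b \<Rightarrow> complex) \<Rightarrow> 'b \<Rightarrow> complex" where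
  "poly_shift p y f = (\<Sum>i\<le>degree p. cscale (coeff p i) ((shift y ^^ i) f))"

lemma poly_shift_eq:
  assumes "degree p \<le> n"
  shows "poly_shift p y f = (\<Sum>i\<le>n. cscale (coeff p i) ((shift y ^^ i) f))"
  unfolding poly_shift_def
  by (rule sum.mono_neutral_left) (use assms in \<open>auto simp: coeff_eq_0\<close>)

lemma poly_shift_linear_factor:
  "poly_shift ([:- r, 1:] * q) y f = shift y (poly_shift q y f) - cscale r (poly_shift q y f)"
proof -
  let ?n = "degree q"
  let ?t = "\<lambda>i. (shift y ^^ i) f"
  have "degree ([:- r, 1:] * q) \<le> Suc ?n"
    using degree_mult_le[of "[:- r, 1:]" q] by simp
  then have "poly_shift ([:- r, 1:] * q) y f = (\<Sum>i\<le>Suc ?n. cscale (coeff ([:- r, 1:] * q) i) (?t i))"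
    by (rule poly_shift_eq)
  also have "\<dots> = (\<Sum>i\<le>Suc ?n. cscale (coeff (pCons 0 q) i) (?t i) - cscale r (cscale (coeff q i) (?t i)))"
    by (intro sum.cong refl) (simp add: cfun.scale_left_diff_distrib[symmetric])
  also have "\<dots> = (\<Sum>i\<le>Suc ?n. cscale (coeff (pCons 0 q) i) (?t i)) - cscale r (\<Sum>i\<le>Suc ?n. cscale (coeff q i) (?t i))"
    by (simp add: sum_subtractf cfun.scale_sum_right del: sum.atMost_Suc)
  \<comment> \<open>Both sums run to \<open>Suc ?n\<close>. There \<open>coeff q\<close> vanishes;
    for \<open>pCons 0 q\<close> the term at index 0 vanishes and the rest is an index
    shift.\<close>
  also have "(\<Sum>i\<le>Suc ?n. cscale (coeff q i) (?t i)) = poly_shift q y f"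
    by (rule poly_shift_eq[symmetric]) simp
  also have "(\<Sum>i\<le>Suc ?n. cscale (coeff (pCons 0 q) i) (?t i)) = (\<Sum>i\<le>?n. cscale (coeff q i) (?t (Suc i)))"
    by (subst sum.atMost_Suc_shift) simp
  also have "\<dots> = shift y (poly_shift q y f)"
    by (simp add: poly_shift_def shift_sum shift_cscale)
  finally show ?thesis .
qed

context
  fixes V :: "('b::ab_group_add \<Rightarrow> complex) set"
  assumes sub: "cfun.subspace V" and inv: "\<And>y f. f \<in> V \<Longrightarrow> shift y f \<in> V"
begin

lemma funpow_shift_in: "f \<in> V \<Longrightarrow> (shift y ^^ i) f \<in> V"
  by (induction i) (auto intro: inv)

lemma poly_shift_in: "f \<in> V \<Longrightarrow> poly_shift p y f \<in> V"
  unfolding poly_shift_def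
  by (intro cfun.subspace_sum[OF sub] cfun.subspace_scale[OF sub] funpow_shift_in)

text \<open>By the fundamental theorem of algebra a factor \<open>X - r\<close> splits off
  \<open>p\<close>. Either the cofactor \<open>q\<close>, of lower degree, already annihilates
  \<open>f\<close>, or \<open>poly_shift q y f\<close> is an eigenvector for
  \<open>r\<close>.\<close>

lemma shift_eigenvector_of_annihilator:
  assumes "f \<in> V" "f \<noteq> 0" "p \<noteq> 0" "poly_shift p y f = 0"
  shows "\<exists>g r. g \<in> V \<and> g \<noteq> 0 \<and> shift y g = cscale r g"
  using assms(3,4)
proof (induction "degree p" arbitrary: p)
  case 0
  then obtain c where p: "p = [:c:]" "c \<noteq> 0" using degree_eq_zeroE[of p] by (metis pCons_0_0)
  then have "cscale c f = 0" using 0 by (simp add: poly_shift_def fun_eq_iff)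
  then show ?case using p assms(2) cfun.scale_eq_0_iff by blast
next
  case (Suc n)
  then have "\<not> constant (poly p)" by (simp add: constant_degree)
  then obtain r where "poly p r = 0" using fundamental_theorem_of_algebra by blast
  then obtain q where q: "p = [:- r, 1:] * q" by (auto simp: poly_eq_0_iff_dvd)
  define g where "g = poly_shift q y f"
  have g: "g \<in> V" unfolding g_def by (rule poly_shift_in) fact
  have "shift y g - cscale r g = 0"
    using Suc.prems(2) unfolding q poly_shift_linear_factor g_def .
  then have sg: "shift y g = cscale r g" by simp
  have "q \<noteq> 0" using Suc.prems q by auto
  then have "degree p = Suc (degree q)" unfolding q by (subst degree_mult_eq) auto
  then show ?case using Suc.hyps(1)[of q] Suc.hyps(2) \<open>q \<noteq> 0\<close> g sg
    by (cases "g = 0") (auto simp: g_def)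
qed

text \<open>The first \<open>card B + 1\<close> iterates of \<open>f\<close> lie in the span of
  \<open>B\<close>, so they are dependent and the coefficients form \<open>p\<close>. A repetition
  among the iterates is treated apart, because \<open>cfun.dependent\<close> concerns sets, in which
  equal iterates would merge.\<close>

lemma shift_annihilator:
  assumes "finite B" "V \<subseteq> cfun.span B" "f \<in> V"
  shows "\<exists>p. p \<noteq> 0 \<and> poly_shift p y f = 0"
proof (cases "\<exists>i j. i < j \<and> (shift y ^^ i) f = (shift y ^^ j) f")
  case True
  then obtain i j where ij: "i < j" "(shift y ^^ i) f = (shift y ^^ j) f" by blast
  \<comment> \<open>The repetition says that \<open>X^j - X^i\<close> annihilates
    \<open>f\<close>.\<close>
  define p :: "complex poly" where "p = monom 1 j - monom 1 i"
  have "coeff p j = 1" using ij by (simp add: p_def)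
  then have "p \<noteq> 0" by auto
  have "degree p \<le> j" unfolding p_def using ij
    by (intro degree_diff_le degree_monom_le order_trans[OF degree_monom_le]) auto
  then have "poly_shift p y f = (\<Sum>l\<le>j. cscale (coeff p l) ((shift y ^^ l) f))" by (rule poly_shift_eq)
  also have "\<dots> = (\<Sum>l\<in>{i, j}. cscale (coeff p l) ((shift y ^^ l) f))"
    by (rule sum.mono_neutral_right) (use ij in \<open>auto simp: p_def\<close>)
  also have "\<dots> = 0" using ij by (auto simp: p_def)
  finally show ?thesis using \<open>p \<noteq> 0\<close> by blast
next
  case False
  let ?t = "\<lambda>i. (shift y ^^ i) f"
  have inj: "inj ?t" using False by (auto intro!: linorder_injI)
  define S where "S = ?t ` {..card B}"
  have "card S = Suc (card B)" unfolding S_def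
    by (subst card_image) (auto intro: inj_on_subset[OF inj])
  moreover have "S \<subseteq> cfun.span B" using assms funpow_shift_in by (auto simp: S_def)
  ultimately have "cfun.dependent S" using cfun.independent_span_bound[OF assms(1), of S] by auto
  then obtain u where u: "\<exists>v\<in>S. u v \<noteq> 0" "(\<Sum>v\<in>S. cscale (u v) v) = 0"
    by (subst (asm) cfun.dependent_finite) (auto simp: S_def)
  define p where "p = (\<Sum>i\<le>card B. monom (u (?t i)) i)"
  have cp: "coeff p i = (if i \<le> card B then u (?t i) else 0)" for i
    by (simp add: p_def coeff_sum if_distrib sum.delta)
  have "p \<noteq> 0"
  proof
    assume "p = 0"
    then have "u (?t i) = 0" if "i \<le> card B" for i using cp[of i] that by simp
    then show False using u(1) by (auto simp: S_def)
  qed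
  moreover have "degree p \<le> card B" by (rule degree_le) (simp add: cp)
  then have "poly_shift p y f = (\<Sum>i\<le>card B. cscale (u (?t i)) (?t i))"
    by (subst poly_shift_eq) (auto simp: cp)
  then have "poly_shift p y f = (\<Sum>v\<in>S. cscale (u v) v)"
    unfolding S_def by (subst sum.reindex) (auto intro: inj_on_subset[OF inj])
  ultimately show ?thesis using u(2) by auto
qed

end

text \<open>In a translation-invariant subspace of minimal dimension each eigenspace of a shift is
  again translation-invariant, hence everything.\<close>

lemma common_shift_eigenvector:
  fixes E :: "('b::ab_group_add \<Rightarrow> complex) set"
  assumes sub: "cfun.subspace E" and inv: "\<And>y f. f \<in> E \<Longrightarrow> shift y f \<in> E"
    and B: "finite B" "E \<subseteq> cfun.span B" and f: "f \<in> E" "f \<noteq> 0"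
  obtains g where "g \<in> E" "g \<noteq> 0" "\<And>y. \<exists>r. shift y g = cscale r g"
proof -
  define P where "P V \<longleftrightarrow> cfun.subspace V \<and> (\<forall>y. \<forall>f\<in>V. shift y f \<in> V) \<and> V \<subseteq> E \<and> (\<exists>f\<in>V. f \<noteq> 0)" for V
  have "P E" using assms by (auto simp: P_def)
  then obtain V where V: "P V" and min: "\<And>W. P W \<Longrightarrow> cfun.dim V \<le> cfun.dim W"
    using ex_has_least_nat[of P E cfun.dim] by blast
  have fin: "finite S \<and> card S \<le> card B" if "S \<subseteq> E" "cfun.independent S" for S
    using cfun.independent_span_bound[OF B(1) that(2)] B(2) that(1) by blast
  \<comment> \<open>A vector of \<open>V\<close> outside \<open>W\<close> would enlarge a basis of
    \<open>W\<close> to an independent set inside \<open>V\<close>, so \<open>W\<close> would have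
    smaller dimension than the minimal \<open>V\<close>.\<close>
  have eqV: "W = V" if W: "P W" "W \<subseteq> V" for W
  proof (rule ccontr)
    assume "W \<noteq> V"
    then obtain v where v: "v \<in> V" "v \<notin> W" using W by blast
    obtain C where C: "C \<subseteq> W" "cfun.independent C" "W \<subseteq> cfun.span C" "card C = cfun.dim W"
      using cfun.basis_exists by blast
    obtain D where D: "D \<subseteq> V" "cfun.independent D" "V \<subseteq> cfun.span D" "card D = cfun.dim V"
      using cfun.basis_exists by blast
    have "cfun.span C \<subseteq> W" using C W by (intro cfun.span_minimal) (auto simp: P_def)
    then have vC: "v \<notin> cfun.span C" using v by blast
    then have "cfun.independent (insert v C)" by (intro cfun.independent_insertI C)
    moreover have "finite D" "finite C" using fin D C V W by (auto simp: P_def)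
    moreover have "insert v C \<subseteq> cfun.span D" using C W v D by blast
    ultimately have "card (insert v C) \<le> card D" using cfun.independent_span_bound by blast
    moreover have "v \<notin> C" using vC cfun.span_base by blast
    ultimately show False using min[OF W(1)] C D \<open>finite C\<close> by simp
  qed
  have ev: "\<exists>r. \<forall>g\<in>V. shift y g = cscale r g" for y
  proof -
    have V': "cfun.subspace V" "\<And>y f. f \<in> V \<Longrightarrow> shift y f \<in> V" "V \<subseteq> cfun.span B"
      using V B by (auto simp: P_def)
    obtain h where h: "h \<in> V" "h \<noteq> 0" using V by (auto simp: P_def)
    obtain p where "p \<noteq> 0" "poly_shift p y h = 0"
      using shift_annihilator[OF V'(1,2) B(1) V'(3) h(1)] by blast
    then obtain g r where g: "g \<in> V" "g \<noteq> 0" "shift y g = cscale r g"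
      using shift_eigenvector_of_annihilator[OF V'(1,2) h] by blast
    define W where "W = {g \<in> V. shift y g = cscale r g}"
    have "cfun.subspace W"
      unfolding cfun.subspace_def W_def using V'(1)
      by (auto simp: cfun.subspace_def shift_add shift_cscale cfun.scale_right_distrib cfun.scale_left_commute)
         (simp add: shift_def fun_eq_iff)
    moreover have "shift z f \<in> W" if "f \<in> W" for z f
      using that V'(2) by (simp add: W_def shift_commute[of y z] shift_cscale)
    ultimately have "P W" using g V by (auto simp: P_def W_def)
    then have "W = V" by (rule eqV) (auto simp: W_def)
    then show ?thesis by (auto simp: W_def)
  qed
  obtain g where "g \<in> V" "g \<noteq> 0" using V by (auto simp: P_def)
  moreover have "\<exists>r. shift y g = cscale r g" for y using ev[of y] \<open>g \<in> V\<close> by blast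
  ultimately show ?thesis using V by (intro that[of g]) (auto simp: P_def)
qed

text \<open>The eigenvalue \<open>r y\<close> of \<open>shift y\<close> on \<open>g\<close> equals
  \<open>g (x0 + y) / g x0\<close>. As a function of \<open>y\<close> it is a multiple of a shift of
  \<open>g\<close>, hence in \<open>E\<close>, and it is multiplicative because shifts
  compose.\<close>

lemma character_in_invariant_subspace:
  fixes E :: "('b::ab_group_add \<Rightarrow> complex) set"
  assumes sub: "cfun.subspace E" and inv: "\<And>y f. f \<in> E \<Longrightarrow> shift y f \<in> E"
    and B: "finite B" "E \<subseteq> cfun.span B" and f: "f \<in> E" "f \<noteq> 0"
  obtains c where "c \<in> E" "c 0 = 1" "\<And>x y. c (x + y) = c x * c y"
proof -
  obtain g where g: "g \<in> E" "g \<noteq> 0" "\<And>y. \<exists>r. shift y g = cscale r g"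
    using common_shift_eigenvector[OF assms] by metis
  obtain x0 where x0: "g x0 \<noteq> 0" using g(2) by (auto simp: fun_eq_iff)
  obtain r where r: "\<And>y. shift y g = cscale (r y) g" using g(3) by metis
  then have gr: "g (x + y) = r y * g x" for x y
    unfolding shift_def cscale_def by metis
  have r_eq: "r y = g (x0 + y) / g x0" for y using gr[of x0 y] x0 by simp
  have "r = cscale (1 / g x0) (shift x0 g)"
    by (auto simp: fun_eq_iff r_eq cscale_def shift_def add.commute)
  then have "r \<in> E" using cfun.subspace_scale[OF sub] inv[OF g(1)] by metis
  moreover have "r 0 = 1" using x0 by (simp add: r_eq)
  moreover have "r (x + y) = r x * r y" for x y
  proof -
    have "r (x + y) * g x0 = g (x0 + x + y)" using gr[of x0 "x + y"] by (simp add: add.assoc)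
    also have "\<dots> = r y * (r x * g x0)" by (simp only: gr)
    finally show ?thesis using x0 by simp
  qed
  ultimately show ?thesis by (rule that)
qed

section \<open>Characters separate points\<close>

lemma is_mean_sum:
  assumes "\<And>i. i \<in> I \<Longrightarrow> is_mean (f i) (c i)"
  shows "is_mean (\<lambda>x. \<Sum>i\<in>I. f i x) (\<Sum>i\<in>I. c i)"
  using assms
proof (induction I rule: infinite_finite_induct)
  case (insert i I)
  have "is_mean (\<lambda>x. f i x + (\<Sum>i\<in>I. f i x)) (c i + (\<Sum>i\<in>I. c i))"
    by (rule is_mean_add) (use insert in auto)
  then show ?case using insert by simp
qed (auto simp: is_mean_const)

lemma sum_fun_apply: "sum f I x = (\<Sum>i\<in>I. f i x)"
  by (induction I rule: infinite_finite_induct) auto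

context compact_ab_group
begin

definition orthonormal :: "('a \<Rightarrow> complex) set \<Rightarrow> bool" where
  "orthonormal B \<longleftrightarrow> (\<forall>b\<in>B. \<forall>b'\<in>B. ip b b' = (if b = b' then 1 else 0))"

lemma ip_orthonormal_combination:
  assumes "finite B" "orthonormal B" "\<And>b. b \<in> B \<Longrightarrow> continuous_on UNIV b" "b' \<in> B"
  shows "ip (\<lambda>x. \<Sum>b\<in>B. c b * b x) b' = c b'"
proof -
  have "ip (\<lambda>x. \<Sum>b\<in>B. c b * b x) b' = (\<Sum>b\<in>B. ip (\<lambda>x. c b * b x) b')"
    by (rule ip_sum_left) (use assms in \<open>auto intro!: continuous_intros\<close>)
  also have "\<dots> = (\<Sum>b\<in>B. if b = b' then c b else 0)"
    by (rule sum.cong) (use assms in \<open>auto simp: ip_cmult_left orthonormal_def\<close>)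
  finally show ?thesis using assms by (simp add: sum.delta)
qed

text \<open>Testing the sup bound on the reproducing kernel \<open>\<Sum>b\<in>B. cnj (b x) b\<close> bounds
  \<open>\<Sum>b\<in>B. \<bar>b x\<bar>\<^sup>2\<close> pointwise, and the mean of this sum is the cardinality of \<open>B\<close>.\<close>

lemma card_orthonormal_le:
  fixes E :: "('a \<Rightarrow> complex) set"
  assumes sub: "cfun.subspace E" and cont: "\<And>u. u \<in> E \<Longrightarrow> continuous_on UNIV u"
    and bound: "\<And>u x. u \<in> E \<Longrightarrow> cmod (u x) \<le> C * nrm u"
    and B: "finite B" "B \<subseteq> E" "orthonormal B"
  shows "real (card B) \<le> C\<^sup>2"
proof -
  have contB: "continuous_on UNIV b" if "b \<in> B" for b using cont B that by blast
  have pt: "(\<Sum>b\<in>B. (cmod (b x))\<^sup>2) \<le> C\<^sup>2" for x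
  proof -
    define D where "D = (\<Sum>b\<in>B. (cmod (b x))\<^sup>2)"
    define u where "u = (\<lambda>y. \<Sum>b\<in>B. cnj (b x) * b y)"
    have "u = (\<Sum>b\<in>B. cscale (cnj (b x)) b)"
      by (simp add: u_def cscale_def fun_eq_iff sum_fun_apply)
    also have "\<dots> \<in> E"
      by (intro cfun.subspace_sum[OF sub] cfun.subspace_scale[OF sub]) (use B in blast)
    finally have uE: "u \<in> E" .
    note uc = cont[OF uE]
    have ux: "u x = of_real D" unfolding u_def D_def of_real_sum
      by (intro sum.cong refl) (simp add: complex_norm_square mult.commute del: of_real_power)
    have "ip u u = (\<Sum>b\<in>B. ip (\<lambda>y. cnj (b x) * b y) u)"
      by (subst (1) u_def, rule ip_sum_left) (auto intro: continuous_on_mult_left contB uc)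
    also have "\<dots> = (\<Sum>b\<in>B. cnj (b x) * b x)"
    proof (rule sum.cong[OF refl])
      fix b assume b: "b \<in> B"
      have "ip b u = cnj (ip u b)" by (rule ip_commute[OF uc contB[OF b]])
      also have "ip u b = cnj (b x)" unfolding u_def
        by (rule ip_orthonormal_combination) (use B contB b in auto)
      finally show "ip (\<lambda>y. cnj (b x) * b y) u = cnj (b x) * b x"
        by (simp add: ip_cmult_left contB[OF b] uc)
    qed
    also have "\<dots> = u x" by (simp add: u_def)
    \<comment> \<open>Reproducing property: \<open>ip u u = u x = D\<close>, so the sup bound at
      \<open>x\<close> becomes a quadratic inequality for \<open>nrm u\<close>.\<close>
    finally have "(nrm u)\<^sup>2 = D" unfolding ux is_mean_nrm(2)[OF uc] of_real_eq_iff .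
    have "D \<ge> 0" by (simp add: D_def sum_nonneg)
    then have "D \<le> C * nrm u" using bound[OF uE, of x] by (simp add: ux)
    then have "(nrm u)\<^sup>2 \<le> C * nrm u" by (simp add: \<open>(nrm u)\<^sup>2 = D\<close>)
    moreover have "nrm u \<ge> 0" by (rule nrm_nonneg[OF uc])
    ultimately have "nrm u = 0 \<or> nrm u \<le> C" by (auto simp: power2_eq_square mult_le_cancel_right)
    then have "(nrm u)\<^sup>2 \<le> C\<^sup>2" using \<open>nrm u \<ge> 0\<close> by (auto intro: power_mono)
    then show ?thesis using \<open>(nrm u)\<^sup>2 = D\<close> by (simp add: D_def)
  qed
  have nrm1: "(nrm b)\<^sup>2 = 1" if "b \<in> B" for b
    using is_mean_nrm(2)[OF contB[OF that]] B(3) that unfolding orthonormal_def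
    by (metis of_real_eq_1_iff)
  have "is_mean (\<lambda>x. \<Sum>b\<in>B. (cmod (b x))\<^sup>2) (\<Sum>b\<in>B. (nrm b)\<^sup>2)"
    by (rule is_mean_sum[OF is_mean_nrm(1)[OF contB]])
  from is_mean_norm_le[OF this, of "C\<^sup>2"] pt have "norm (\<Sum>b\<in>B. (nrm b)\<^sup>2) \<le> C\<^sup>2"
    by (auto simp: sum_nonneg)
  then show ?thesis using nrm1 by simp
qed

text \<open>\<open>card_orthonormal_le\<close> bounds the finite orthonormal subsets of
  \<open>E\<close>, so one of maximal size exists; a Gram-Schmidt step would extend it by any vector
  outside its span.\<close>

lemma finite_spanning_set:
  fixes E :: "('a \<Rightarrow> complex) set"
  assumes sub: "cfun.subspace E" and cont: "\<And>u. u \<in> E \<Longrightarrow> continuous_on UNIV u"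
    and bound: "\<And>u x. u \<in> E \<Longrightarrow> cmod (u x) \<le> C * nrm u"
  shows "\<exists>B. finite B \<and> E \<subseteq> cfun.span B"
proof -
  define P where "P B \<longleftrightarrow> finite B \<and> B \<subseteq> E \<and> orthonormal B" for B
  have le: "card B < Suc (nat \<lceil>C\<^sup>2\<rceil>)" if "P B" for B
    using card_orthonormal_le[OF sub cont bound, of B] that unfolding P_def by linarith
  have "P {}" by (simp add: P_def orthonormal_def)
  then obtain B where B: "P B" and max: "\<And>B'. P B' \<Longrightarrow> card B' \<le> card B"
    using ex_has_greatest_nat[of P "{}" card] le by (metis less_imp_le)
  have contB: "continuous_on UNIV b" if "b \<in> B" for b using cont B that by (auto simp: P_def)
  have "u \<in> cfun.span B" if u: "u \<in> E" for u
  proof (rule ccontr)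
    assume nin: "u \<notin> cfun.span B"
    define p where "p = (\<Sum>b\<in>B. cscale (ip u b) b)"
    have pspan: "p \<in> cfun.span B" unfolding p_def
      by (intro cfun.span_sum cfun.span_scale cfun.span_base)
    have p': "p = (\<lambda>x. \<Sum>b\<in>B. ip u b * b x)"
      by (simp add: p_def cscale_def fun_eq_iff sum_fun_apply)
    have "cfun.span B \<subseteq> E" using B sub by (intro cfun.span_minimal) (auto simp: P_def)
    then have pE: "p \<in> E" using pspan by blast
    have vE: "u - p \<in> E" by (intro cfun.subspace_diff[OF sub] u pE)
    have vm: "u - p = (\<lambda>x. u x - p x)" by (simp add: fun_eq_iff)
    have orth: "ip (u - p) b = 0" if b: "b \<in> B" for b
      unfolding vm ip_diff_left[OF cont[OF u] cont[OF pE] contB[OF b]]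
      using ip_orthonormal_combination[of B b "ip u"] b B contB by (simp add: p' P_def)
    have "u - p \<noteq> 0" using nin pspan by auto
    then have "nrm (u - p) \<noteq> 0" using nrm_eq_0D[OF cont[OF vE]] by (auto simp: fun_eq_iff)
    then have pos: "nrm (u - p) > 0" using nrm_nonneg[OF cont[OF vE]] by simp
    define c where "c = complex_of_real (inverse (nrm (u - p)))"
    define b0 where "b0 = (\<lambda>x. c * (u - p) x)"
    have "b0 = cscale c (u - p)" by (simp add: b0_def cscale_def)
    then have b0E: "b0 \<in> E" using cfun.subspace_scale[OF sub vE] by simp
    have orth0: "ip b0 b = 0" if "b \<in> B" for b
      unfolding b0_def ip_cmult_left[OF cont[OF vE] contB[OF that]] orth[OF that] by simp
    then have orth0': "ip b b0 = 0" if "b \<in> B" for b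
      using ip_commute[OF cont[OF b0E] contB[OF that]] that by simp
    have "nrm b0 = 1"
      unfolding b0_def nrm_cmult[OF cont[OF vE]] c_def norm_of_real using pos by simp
    then have one: "ip b0 b0 = 1" using is_mean_nrm(2)[OF cont[OF b0E]] by simp
    then have "b0 \<notin> B" using orth0 by force
    have "P (insert b0 B)"
      using B b0E orth0 orth0' one \<open>b0 \<notin> B\<close> by (auto simp: P_def orthonormal_def)
    from max[OF this] show False using \<open>b0 \<notin> B\<close> B by (simp add: P_def)
  qed
  then show ?thesis using B by (auto simp: P_def)
qed

end

context hermitian_kernel
begin

text \<open>The eigenspace \<open>E\<close> of the squared operator is translation-invariant because
  convolution commutes with shifts, and finite-dimensional because
  \<open>u = conv k (conv k u) / \<mu>\<close> bounds the sup norm by a multiple of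
  \<open>nrm u\<close>.\<close>

theorem character_of_kernel:
  assumes u0: "continuous_on UNIV u0" "conv k u0 x0 \<noteq> 0"
  obtains c where "continuous_on UNIV c" "c 0 = 1" "\<And>x y. c (x + y) = c x * c y"
    "conv k (conv k c) \<noteq> 0"
proof -
  obtain \<mu> w where \<mu>: "\<mu> > 0" and w: "continuous_on UNIV w" "\<exists>x. w x \<noteq> 0"
    "conv k (conv k w) = (\<lambda>x. of_real \<mu> * w x)"
    using eigenfunction_exists[OF u0] by blast
  define E where "E = {u. continuous_on UNIV u \<and> conv k (conv k u) = (\<lambda>x. of_real \<mu> * u x)}"
  have cont: "continuous_on UNIV u" if "u \<in> E" for u using that by (simp add: E_def)
  have sub: "cfun.subspace E"
  proof (rule cfun.subspaceI)
    have "conv k (\<lambda>_. 0) = (\<lambda>_. 0)" by (simp add: conv_def mean_const fun_eq_iff)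
    then show "0 \<in> E" by (simp add: E_def zero_fun_def)
  next
    fix u v assume "u \<in> E" "v \<in> E"
    then show "u + v \<in> E"
      by (auto simp: E_def plus_fun_def conv_add conv_cont algebra_simps intro!: continuous_intros)
  next
    fix c u assume "u \<in> E"
    then show "cscale c u \<in> E"
      by (auto simp: E_def cscale_def conv_cmult conv_cont algebra_simps intro!: continuous_intros)
  qed
  have inv: "shift y u \<in> E" if "u \<in> E" for y u
  proof -
    have c: "continuous_on UNIV (\<lambda>x. v (x + y))" if "continuous_on UNIV v" for v :: "'a \<Rightarrow> complex"
      by (intro continuous_on_compose2[OF that] continuous_intros) auto
    show ?thesis using that
      by (auto simp: E_def shift_def conv_translate c conv_cont)
  qed
  have bound: "cmod (u x) \<le> (K * K / \<mu>) * nrm u" if u: "u \<in> E" for u x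
  proof -
    note uc = cont[OF u]
    have "\<mu> * cmod (u x) = cmod (conv k (conv k u) x)"
      using u \<mu> by (simp add: E_def norm_mult)
    also have "\<dots> \<le> K * nrm (conv k u)" by (intro conv_bound conv_cont uc)
    also have "\<dots> \<le> K * (K * nrm u)" by (intro mult_left_mono nrm_conv_le uc K_nonneg)
    finally show ?thesis using \<mu> by (simp add: field_simps)
  qed
  obtain B where B: "finite B" "E \<subseteq> cfun.span B"
    using finite_spanning_set[OF sub cont bound] by blast
  have "w \<in> E" "w \<noteq> 0" using w by (auto simp: E_def)
  then obtain c where c: "c \<in> E" "c 0 = 1" "\<And>x y. c (x + y) = c x * c y"
    using character_in_invariant_subspace[OF sub inv B] by metis
  \<comment> \<open>The eigenvalue equation at 0 gives the value
    \<open>\<mu> * c 0 = \<mu>\<close>.\<close>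
  have "conv k (conv k c) 0 \<noteq> 0" using c \<mu> by (simp add: E_def)
  then have "conv k (conv k c) \<noteq> 0" by (metis zero_fun_apply)
  then show ?thesis using c cont by (intro that[of c]) auto
qed

end

context compact_ab_group
begin

text \<open>A value of modulus above 1 would have unbounded powers, which are again values of the
  bounded function \<open>c\<close>. Since the values at \<open>x\<close> and \<open>- x\<close>
  multiply to 1, neither modulus can be below 1.\<close>

lemma norm_character:
  assumes c: "continuous_on UNIV (c :: 'a \<Rightarrow> complex)" "c 0 = 1" "\<And>x y. c (x + y) = c x * c y"
  shows "cmod (c x) = 1"
proof -
  obtain B where B: "\<And>x. cmod (c x) \<le> B" using bounded_cont[OF c(1)] by blast
  have le: "cmod (c x) \<le> 1" for x
  proof (rule ccontr)
    assume "\<not> cmod (c x) \<le> 1"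
    then obtain n where n: "B < cmod (c x) ^ n" using real_arch_pow[of "cmod (c x)" B] by auto
    have "\<exists>y. c y = c x ^ n"
    proof (induction n)
      case (Suc n)
      then show ?case using c(3) by (metis power_Suc)
    qed (use c in auto)
    then show False using B n by (metis norm_power not_le)
  qed
  have "c x * c (- x) = 1" using c(3)[of x "- x"] c(2) by simp
  then have "cmod (c x) * cmod (c (- x)) = 1" by (metis norm_mult norm_one)
  moreover have "cmod (c x) * cmod (c (- x)) \<le> cmod (c x) * 1" by (intro mult_left_mono le) auto
  ultimately show ?thesis using le[of x] by simp
qed

end

theorem characters_separate_points:
  fixes \<beta> :: "'a::{topological_ab_group_add, t2_space}"
  assumes comp: "compact (UNIV :: 'a set)" and "\<beta> \<noteq> 0"
  obtains c :: "'a \<Rightarrow> complex" where "continuous_on UNIV c" "c 0 = 1" "\<And>x y. c (x + y) = c x * c y"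
    "\<And>x. cmod (c x) = 1" "c \<beta> \<noteq> 1"
proof -
  interpret compact_ab_group "TYPE('a)" by standard (rule comp)
  have "compact_space (euclidean :: 'a topology)" by (simp add: compact_space_def comp)
  moreover have "Hausdorff_space (euclidean :: 'a topology)"
    unfolding Hausdorff_space_def using hausdorff by (fastforce simp: disjnt_def)
  ultimately have norm: "normal_space (euclidean :: 'a topology)"
    by (intro compact_Hausdorff_or_regular_imp_normal_space) auto
  \<comment> \<open>Sending both \<open>\<beta>\<close> and \<open>- \<beta>\<close> to 0 makes the
    symmetrised \<open>g\<close> vanish at both, while \<open>g 0 = 2\<close>; hence
    \<open>k 0 = 4\<close>.\<close>
  obtain u :: "'a \<Rightarrow> real" where u: "continuous_map euclidean (top_of_set {0..1}) u"
    "u ` {\<beta>, - \<beta>} \<subseteq> {0}" "u ` {0} \<subseteq> {1}"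
    by (rule Urysohn_lemma[OF norm, of "{\<beta>, - \<beta>}" "{0}" 0 1])
       (use assms in \<open>auto simp: disjnt_def\<close>)
  then have uc: "continuous_on UNIV u" by (simp add: continuous_map_in_subtopology)
  define g where "g x = u x + u (- x)" for x
  \<comment> \<open>A negated second difference of \<open>g\<close> along \<open>\<beta>\<close>:
    real and even, hence hermitian, and convolution with it annihilates continuous functions of
    period \<open>\<beta>\<close>.\<close>
  define k where "k x = complex_of_real (2 * g x - g (x + \<beta>) - g (x - \<beta>))" for x
  have gc: "continuous_on UNIV g" unfolding g_def
    by (intro continuous_intros continuous_on_compose2[OF uc]) auto
  have kc: "continuous_on UNIV k" unfolding k_def
    by (intro continuous_intros continuous_on_compose2[OF gc]) auto
  obtain K where K: "\<And>x. cmod (k x) \<le> K" using bounded_cont[OF kc] by blast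
  have gs: "g (- x) = g x" for x by (simp add: g_def)
  have "g (- x + \<beta>) = g (x - \<beta>)" "g (- x - \<beta>) = g (x + \<beta>)" for x
    using gs[of "x - \<beta>"] gs[of "x + \<beta>"] by simp_all
  then have ks: "k (- x) = cnj (k x)" for x by (simp add: k_def gs)
  interpret hermitian_kernel "TYPE('a)" k K by standard (fact kc ks K)+
  have "g 0 = 2" "g \<beta> = 0" "g (- \<beta>) = 0" using u by (auto simp: g_def)
  then have k0: "k 0 \<noteq> 0" by (simp add: k_def)
  \<comment> \<open>\<open>k\<close> itself is the test function: by \<open>k_herm\<close>,
    \<open>conv k k 0\<close> is its squared norm.\<close>
  have "conv k k 0 \<noteq> 0"
  proof
    assume "conv k k 0 = 0"
    then have "ip k k = 0" by (simp add: conv_def ip_def k_herm mult.commute)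
    then have "nrm k = 0" by (simp add: nrm_def)
    then show False using nrm_eq_0D[OF kc] k0 by blast
  qed
  then obtain c where c: "continuous_on UNIV c" "c 0 = 1" "\<And>x y. c (x + y) = c x * c y"
    "conv k (conv k c) \<noteq> 0"
    using character_of_kernel[OF kc] by blast
  have "c \<beta> \<noteq> 1"
  proof
    assume c1: "c \<beta> = 1"
    then have inv: "c (x + \<beta>) = c x" for x by (simp add: c)
    have inv': "c (x - \<beta>) = c x" for x using inv[of "x - \<beta>"] by simp
    have "conv k c x = 0" for x
    proof -
      define f where "f a y = complex_of_real (g (x - y + a)) * c y" for a y
      have fc: "continuous_on UNIV (f a)" for a unfolding f_def
        by (intro continuous_intros continuous_on_compose2[OF gc] c) auto
      \<comment> \<open>As \<open>c\<close> has period \<open>\<beta>\<close>, the three pieces of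
        the kernel have the same mean after translating \<open>y\<close>, and the weights 2, -1, -1
        cancel.\<close>
      have "f \<beta> (y + \<beta>) = f 0 y" "f (- \<beta>) (y + - \<beta>) = f 0 y" for y
        using inv[of y] inv'[of y] by (simp_all add: f_def algebra_simps)
      then have m: "mean (f \<beta>) = mean (f 0)" "mean (f (- \<beta>)) = mean (f 0)"
        using mean_translate[OF fc, of \<beta> \<beta>] mean_translate[OF fc, of "- \<beta>" "- \<beta>"] by simp_all
      have "conv k c x = mean (\<lambda>y. (2 * f 0 y - f \<beta> y) - f (- \<beta>) y)"
        by (simp add: conv_def k_def f_def algebra_simps)
      also have "\<dots> = mean (\<lambda>y. 2 * f 0 y - f \<beta> y) - mean (f (- \<beta>))"
        by (rule mean_diff) (intro continuous_intros fc)+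
      also have "mean (\<lambda>y. 2 * f 0 y - f \<beta> y) = mean (\<lambda>y. 2 * f 0 y) - mean (f \<beta>)"
        by (rule mean_diff) (intro continuous_intros fc)+
      also have "mean (\<lambda>y. 2 * f 0 y) = 2 * mean (f 0)" by (rule mean_cmult[OF fc])
      finally show ?thesis by (simp add: m)
    qed
    then have "conv k c = (\<lambda>_. 0)" by (rule ext)
    then have "conv k (conv k c) = 0" by (simp add: conv_def mean_const fun_eq_iff)
    then show False using c(4) by simp
  qed
  then show ?thesis using c norm_character[OF c(1-3)] by (intro that[of c]) auto
qed

section \<open>The circle and the dual group\<close>

text \<open>Identifies R/Z with the unit circle in \<open>complex\<close>, through which continuity
  and estimates on \<open>circle\<close> are obtained.\<close>

lift_definition circle_exp :: "circle \<Rightarrow> complex" is "\<lambda>r. cis (2 * pi * r)"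
proof -
  fix x y :: real assume "x - y \<in> \<int>"
  then obtain n where "x - y = of_int n" by (auto elim: Ints_cases)
  then have "2 * pi * x = 2 * pi * y + 2 * pi * of_int n" by (simp add: algebra_simps)
  then show "cis (2 * pi * x) = cis (2 * pi * y)"
    by (simp add: cis_mult[symmetric] cis_multiple_2pi)
qed

lemma circle_exp_0 [simp]: "circle_exp 0 = 1"
  by transfer simp

lemma circle_exp_add: "circle_exp (a + b) = circle_exp a * circle_exp b"
  by transfer (simp add: cis_mult distrib_left)

lemma norm_circle_exp [simp]: "cmod (circle_exp a) = 1"
  by transfer simp

lemma circle_exp_minus: "circle_exp (- a) = cnj (circle_exp a)"
  by transfer (simp add: cis_cnj)

lemma circle_exp_diff: "circle_exp (a - b) = circle_exp a * cnj (circle_exp b)"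
  using circle_exp_add[of a "- b"] by (simp add: circle_exp_minus)

lemma circle_exp_eq_1D: "circle_exp a = 1 \<Longrightarrow> a = 0"
proof transfer
  fix r assume "cis (2 * pi * r) = 1"
  then have "cos (2 * pi * r) = 1" by (simp add: complex_eq_iff)
  then obtain n :: int where "2 * pi * r = of_int n * 2 * pi" by (auto simp: cos_one_2pi_int)
  then have "r = of_int n" by simp
  then show "r - 0 \<in> \<int>" by simp
qed

lemma inj_circle_exp: "inj circle_exp"
proof (rule injI)
  fix a b assume "circle_exp a = circle_exp b"
  then have "circle_exp (a - b) = 1"
    using complex_norm_square[of "circle_exp b"] by (simp add: circle_exp_diff)
  then show "a = b" using circle_exp_eq_1D by fastforce
qed

lemma continuous_of_real_circle: "continuous_on UNIV of_real_circle"
  by (auto simp: continuous_on_open_vimage open_circle_def)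

lemma continuous_circle_exp: "continuous_on UNIV circle_exp"
proof -
  have "open (circle_exp -` U)" if "open U" for U
  proof -
    have "of_real_circle -` circle_exp -` U = (\<lambda>r. cis (2 * pi * r)) -` U"
      by (auto simp: circle_exp.abs_eq)
    moreover have "open ((\<lambda>r. cis (2 * pi * r)) -` U)"
      by (intro open_vimage that continuous_intros)
    ultimately show ?thesis by (simp add: open_circle_def)
  qed
  then show ?thesis by (simp add: continuous_on_open_vimage)
qed

lemma compact_circle: "compact (UNIV :: circle set)"
proof -
  have "a \<in> of_real_circle ` {0..1}" for a
  proof (induction a rule: circle.abs_induct)
    case (1 r)
    have "of_real_circle r = of_real_circle (frac r)"
      by (simp add: circle.abs_eq_iff frac_def)
    then show ?case using frac_ge_0[of r] frac_lt_1[of r] by (intro image_eqI[of _ _ "frac r"]) auto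
  qed
  then have "UNIV = of_real_circle ` {0..1}" by blast
  then show ?thesis
    using compact_continuous_image[OF continuous_on_subset[OF continuous_of_real_circle]]
    by (metis compact_Icc subset_UNIV)
qed

lemma range_circle_exp: "range circle_exp = {z. cmod z = 1}"
proof safe
  fix z assume "cmod z = 1"
  then have "z = cis (Arg z)" using rcis_cmod_Arg[of z] by (simp add: rcis_def)
  then have "z = circle_exp (of_real_circle (Arg z / (2 * pi)))" by (simp add: circle_exp.abs_eq)
  then show "z \<in> range circle_exp" by blast
qed auto

text \<open>A continuous injection of a compact space into a Hausdorff space has a continuous
  inverse on its range. Continuity of the group operations on \<open>circle\<close> rests on
  this.\<close>

lemma continuous_inv_circle_exp: "continuous_on {z. cmod z = 1} (inv circle_exp)"
  using continuous_on_inv[OF continuous_circle_exp compact_circle, of "inv circle_exp"]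
  by (simp add: range_circle_exp inj_circle_exp)

lemma Re_circle_exp: "Re (circle_exp a) = cos (2 * pi * circle_norm a)"
proof transfer
  fix r :: real
  have "cos (2 * pi * \<bar>r - of_int (round r)\<bar>) = cos (2 * pi * (r - of_int (round r)))"
  proof (cases "r - of_int (round r) \<ge> 0")
    case False
    then have "2 * pi * \<bar>r - of_int (round r)\<bar> = - (2 * pi * (r - of_int (round r)))" by (simp add: algebra_simps)
    then show ?thesis by (simp only: cos_minus)
  qed simp
  also have "\<dots> = cos (2 * pi * r)"
    by (simp add: right_diff_distrib cos_diff)
  finally show "Re (cis (2 * pi * r)) = cos (2 * pi * \<bar>r - of_int (round r)\<bar>)" by simp
qed

lemma circle_norm_bounds: "circle_norm a \<ge> 0" "circle_norm a \<le> 1/2"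
  by (transfer, simp, transfer, metis abs_minus_commute of_int_round_abs_le)

lemma norm_circle_exp_minus_1: "(cmod (circle_exp a - 1))\<^sup>2 = 2 - 2 * Re (circle_exp a)"
proof -
  have "(Re (circle_exp a))\<^sup>2 + (Im (circle_exp a))\<^sup>2 = 1"
    using norm_circle_exp[of a] unfolding cmod_def by (metis real_sqrt_eq_1_iff)
  then show ?thesis unfolding cmod_power2 by (simp add: power2_eq_square algebra_simps)
qed

text \<open>\<open>2 * pi * circle_norm a\<close> lies in \<open>[0, pi]\<close>, where
  \<open>cos\<close> is strictly decreasing, so a short chord forces a short arc.\<close>

lemma circle_norm_le_if_exp_near_1:
  assumes "\<epsilon> > 0"
  obtains \<eta> where "\<eta> > 0" "\<And>a. cmod (circle_exp a - 1) \<le> \<eta> \<Longrightarrow> circle_norm a \<le> \<epsilon>"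
proof -
  \<comment> \<open>Capped at 1/2 so that \<open>2 * pi * \<delta>\<close> stays in
    \<open>[0, pi]\<close>.\<close>
  define \<delta> where "\<delta> = min \<epsilon> (1/2)"
  have \<delta>: "0 < \<delta>" "\<delta> \<le> 1/2" "\<delta> \<le> \<epsilon>" using assms by (auto simp: \<delta>_def)
  have "cos (2 * pi * \<delta>) < cos 0" by (rule cos_monotone_0_pi) (use \<delta> in auto)
  then have pos: "2 - 2 * cos (2 * pi * \<delta>) > 0" by simp
  \<comment> \<open>The witness is the length of the chord from 1 to the point at arc distance
    \<open>\<delta>\<close>.\<close>
  show ?thesis
  proof (rule that[of "sqrt (2 - 2 * cos (2 * pi * \<delta>))"])
    show "sqrt (2 - 2 * cos (2 * pi * \<delta>)) > 0" using pos by simp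
    fix a assume a: "cmod (circle_exp a - 1) \<le> sqrt (2 - 2 * cos (2 * pi * \<delta>))"
    have "(cmod (circle_exp a - 1))\<^sup>2 \<le> 2 - 2 * cos (2 * pi * \<delta>)"
      using power_mono[OF a, of 2] pos by simp
    then have le: "cos (2 * pi * \<delta>) \<le> cos (2 * pi * circle_norm a)"
      by (simp add: norm_circle_exp_minus_1 Re_circle_exp)
    have "circle_norm a \<le> \<delta>"
    proof (rule ccontr)
      assume "\<not> circle_norm a \<le> \<delta>"
      then have "cos (2 * pi * circle_norm a) < cos (2 * pi * \<delta>)"
        using \<delta> circle_norm_bounds[of a] by (intro cos_monotone_0_pi) auto
      then show False using le by simp
    qed
    then show "circle_norm a \<le> \<epsilon>" using \<delta> by simp
  qed
qed

text \<open>\<open>circle_norm a\<close> is the absolute value of the representative of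
  \<open>a\<close> nearest to 0, which therefore lies in a small ball inside the preimage of
  \<open>U\<close>.\<close>

lemma circle_norm_nhds_0:
  assumes "open U" "0 \<in> U"
  obtains \<epsilon> where "\<epsilon> > 0" "\<And>a. circle_norm a \<le> \<epsilon> \<Longrightarrow> a \<in> U"
proof -
  have "open (of_real_circle -` U)" "0 \<in> of_real_circle -` U"
    using assms by (auto simp: open_circle_def zero_circle.abs_eq[symmetric])
  then obtain e where e: "e > 0" "cball 0 e \<subseteq> of_real_circle -` U"
    using open_contains_cball by blast
  have "a \<in> U" if "circle_norm a \<le> e" for a
    using that
  proof (induction a rule: circle.abs_induct)
    case (1 r)
    have "r - of_int (round r) \<in> cball 0 e" using 1 by (simp add: circle_norm.abs_eq)
    moreover have "of_real_circle (r - of_int (round r)) = of_real_circle r"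
      by (simp add: circle.abs_eq_iff)
    ultimately show ?case using e(2) by (metis subsetD vimageE)
  qed
  then show ?thesis using e by (intro that[of e]) auto
qed

text \<open>As a type the dual joins the class \<open>ab_group_add\<close>, so that
  \<open>avg\<close> and \<open>is_mean\<close> apply to it, without any topology.\<close>

typedef (overloaded) 'a dual = "dual_group :: ('a::topological_ab_group_add \<Rightarrow> circle) set"
  by (rule exI[of _ "\<lambda>_. 0"]) (simp add: dual_group_def)

setup_lifting type_definition_dual

text \<open>Addition becomes multiplication on the unit circle, where continuity is known, and
  \<open>inv circle_exp\<close> brings it back.\<close>

lemma continuous_add_circle:
  assumes "continuous_on UNIV (f :: 'a::topological_space \<Rightarrow> circle)" "continuous_on UNIV g"
  shows "continuous_on UNIV (\<lambda>x. f x + g x)"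
proof -
  have "continuous_on UNIV (\<lambda>x. circle_exp (f x) * circle_exp (g x))"
    by (intro continuous_intros continuous_on_compose2[OF continuous_circle_exp] assms) auto
  then have "continuous_on UNIV (\<lambda>x. inv circle_exp (circle_exp (f x) * circle_exp (g x)))"
    by (rule continuous_on_compose2[OF continuous_inv_circle_exp]) (auto simp: norm_mult)
  then show ?thesis by (simp add: circle_exp_add[symmetric] inj_circle_exp)
qed

lemma continuous_minus_circle:
  assumes "continuous_on UNIV (f :: 'a::topological_space \<Rightarrow> circle)"
  shows "continuous_on UNIV (\<lambda>x. - f x)"
proof -
  have "continuous_on UNIV (\<lambda>x. cnj (circle_exp (f x)))"
    by (intro continuous_intros continuous_on_compose2[OF continuous_circle_exp] assms) auto
  then have "continuous_on UNIV (\<lambda>x. inv circle_exp (cnj (circle_exp (f x))))"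
    by (rule continuous_on_compose2[OF continuous_inv_circle_exp]) auto
  then show ?thesis by (simp add: circle_exp_minus[symmetric] inj_circle_exp)
qed

lemma continuous_diff_circle:
  assumes "continuous_on UNIV (f :: 'a::topological_space \<Rightarrow> circle)" "continuous_on UNIV g"
  shows "continuous_on UNIV (\<lambda>x. f x - g x)"
  using continuous_add_circle[OF assms(1) continuous_minus_circle[OF assms(2)]] by simp

instantiation dual :: (topological_ab_group_add) ab_group_add
begin

lift_definition zero_dual :: "'a dual" is "\<lambda>_. 0"
  by (simp add: dual_group_def)

lift_definition plus_dual :: "'a dual \<Rightarrow> 'a dual \<Rightarrow> 'a dual" is "\<lambda>\<phi> \<psi> x. \<phi> x + \<psi> x"
  by (simp add: dual_group_def continuous_add_circle)

lift_definition uminus_dual :: "'a dual \<Rightarrow> 'a dual" is "\<lambda>\<phi> x. - \<phi> x"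
  by (simp add: dual_group_def continuous_minus_circle)

lift_definition minus_dual :: "'a dual \<Rightarrow> 'a dual \<Rightarrow> 'a dual" is "\<lambda>\<phi> \<psi> x. \<phi> x - \<psi> x"
  by (simp add: dual_group_def continuous_diff_circle)

instance
  by standard (transfer; simp add: algebra_simps)+

end

text \<open>The point \<open>a\<close> viewed as a character of the dual group, with values in the
  unit circle of \<open>complex\<close>.\<close>

definition ev :: "'a::topological_ab_group_add \<Rightarrow> 'a dual \<Rightarrow> complex" where
  "ev a \<xi> = circle_exp (Rep_dual \<xi> a)"

lemma norm_ev [simp]: "cmod (ev a \<xi>) = 1"
  by (simp add: ev_def)

lemma ev_add: "ev a (\<xi> + \<psi>) = ev a \<xi> * ev a \<psi>"
  by (simp add: ev_def plus_dual.rep_eq circle_exp_add)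

lemma ev_zero [simp]: "ev a 0 = 1"
  by (simp add: ev_def zero_dual.rep_eq)

lemma Rep_dual_add: "Rep_dual \<xi> (a + b) = Rep_dual \<xi> a + Rep_dual \<xi> b"
  using Rep_dual[of \<xi>] by (simp add: dual_group_def)

lemma ev_point_add: "ev (a + b) \<xi> = ev a \<xi> * ev b \<xi>"
  by (simp add: ev_def Rep_dual_add circle_exp_add)

lemma ev_point_0 [simp]: "ev 0 \<xi> = 1"
  using Rep_dual_add[of \<xi> 0 0] by (simp add: ev_def)

lemma ev_mult_cnj [simp]: "ev a \<xi> * cnj (ev a \<xi>) = 1"
  using complex_norm_square[of "ev a \<xi>"] by simp

lemma ev_point_minus: "ev (- a) \<xi> = cnj (ev a \<xi>)"
proof -
  have "ev a \<xi> * ev (- a) \<xi> = ev a \<xi> * cnj (ev a \<xi>)"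
    using ev_point_add[of a "- a" \<xi>] by simp
  then show ?thesis using norm_ev[of a \<xi>] by (metis mult_left_cancel norm_zero zero_neq_one)
qed

lemma ev_ratio: "cmod (ev a (\<xi> - \<psi>) - 1) = cmod (ev a \<xi> - ev a \<psi>)"
proof -
  have "ev a \<xi> - ev a \<psi> = (ev a (\<xi> - \<psi>) - 1) * ev a \<psi>"
    using ev_add[of a "\<xi> - \<psi>" \<psi>] by (simp add: algebra_simps)
  then show ?thesis by (simp add: norm_mult)
qed

theorem dual_separates_points:
  fixes a :: "'a::{topological_ab_group_add, t2_space}"
  assumes "compact (UNIV :: 'a set)" "a \<noteq> 0"
  obtains \<xi> where "ev a \<xi> \<noteq> 1"
proof -
  obtain c :: "'a \<Rightarrow> complex" where c: "continuous_on UNIV c" "c 0 = 1" "\<And>x y. c (x + y) = c x * c y"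
    "\<And>x. cmod (c x) = 1" "c a \<noteq> 1"
    using characters_separate_points[OF assms] by blast
  define \<phi> where "\<phi> x = inv circle_exp (c x)" for x
  have e: "circle_exp (\<phi> x) = c x" for x
    unfolding \<phi>_def by (rule f_inv_into_f) (simp add: range_circle_exp c)
  have "\<phi> (x + y) = \<phi> x + \<phi> y" for x y
    by (rule injD[OF inj_circle_exp]) (simp add: e circle_exp_add c)
  moreover have "continuous_on UNIV \<phi>" unfolding \<phi>_def
    by (rule continuous_on_compose2[OF continuous_inv_circle_exp c(1)]) (use c in auto)
  ultimately have "\<phi> \<in> dual_group" by (simp add: dual_group_def)
  then have "ev a (Abs_dual \<phi>) = c a" by (simp add: ev_def Abs_dual_inverse e)
  then show ?thesis using c(5) that by metis
qed

text \<open>Averaging over \<open>[0, \<xi>]\<close> multiplies \<open>ev a\<close> by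
  \<open>(1 + w) / 2\<close> with \<open>w = ev a \<xi>\<close>. This factor has modulus less than 1
  as \<open>w \<noteq> 1\<close>, so iterated averages tend uniformly to 0.\<close>

lemma is_mean_ev:
  assumes "ev a \<xi> \<noteq> 1"
  shows "is_mean (ev a) 0"
  unfolding is_mean_def
proof safe
  fix e :: real assume e: "e > 0"
  define w where "w = ev a \<xi>"
  have "cmod ((1 + w) / 2) < 1"
  proof -
    have "(Re w)\<^sup>2 + (Im w)\<^sup>2 = 1"
      using norm_ev[of a \<xi>] unfolding cmod_def w_def by (metis real_sqrt_eq_1_iff)
    \<comment> \<open>Parallelogram law for the unit vectors 1 and \<open>w\<close>.\<close>
    then have "(cmod (1 + w))\<^sup>2 + (cmod (1 - w))\<^sup>2 = 4"
      unfolding cmod_power2 by (simp add: power2_eq_square algebra_simps)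
    moreover have "(cmod (1 - w))\<^sup>2 > 0" using assms by (simp add: w_def)
    ultimately have "(cmod (1 + w))\<^sup>2 < 4" by linarith
    then have "(cmod (1 + w))\<^sup>2 < 2\<^sup>2" by simp
    then have "cmod (1 + w) < 2" by (rule power2_less_imp_less) simp
    then show ?thesis by (simp add: norm_divide)
  qed
  then obtain n where n: "cmod ((1 + w) / 2) ^ n < e"
    using real_arch_pow_inv[OF e] by blast
  have step: "avg [0, \<xi>] (ev a) = (\<lambda>\<psi>. ((1 + w) / 2) * ev a \<psi>)"
    by (simp add: avg_def fun_eq_iff ev_add w_def scaleR_conv_of_real field_simps)
  have "\<exists>zs. zs \<noteq> [] \<and> (\<forall>\<psi>. cmod (avg zs (ev a) \<psi>) \<le> cmod ((1 + w) / 2) ^ n)"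
  proof (induction n)
    case 0
    show ?case by (intro exI[of _ "[0]"]) (simp add: avg_def)
  next
    case (Suc n)
    then obtain zs where zs: "zs \<noteq> []" "\<And>\<psi>. cmod (avg zs (ev a) \<psi>) \<le> cmod ((1 + w) / 2) ^ n" by blast
    have "linear (\<lambda>z. ((1 + w) / 2) * z)"
      by (intro bounded_linear.linear bounded_linear_mult_right)
    from avg_linear[OF this]
    have "avg (sumlist zs [0, \<xi>]) (ev a) \<psi> = ((1 + w) / 2) * avg zs (ev a) \<psi>" for \<psi>
      unfolding avg_sumlist step .
    then have "cmod (avg (sumlist zs [0, \<xi>]) (ev a) \<psi>) \<le> cmod ((1 + w) / 2) ^ Suc n" for \<psi>
      using zs(2)[of \<psi>] by (simp only: norm_mult power_Suc) (intro mult_left_mono, auto)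
    then show ?case using zs(1) by (intro exI[of _ "sumlist zs [0, \<xi>]"]) (simp add: sumlist_Nil_iff)
  qed
  then obtain zs where zs: "zs \<noteq> []" "\<And>\<psi>. cmod (avg zs (ev a) \<psi>) \<le> cmod ((1 + w) / 2) ^ n" by blast
  have "cmod (avg zs (ev a) \<psi> - 0) \<le> e" for \<psi>
    unfolding diff_0_right using n zs(2)[of \<psi>] by linarith
  then show "\<exists>zs. zs \<noteq> [] \<and> (\<forall>\<psi>. cmod (avg zs (ev a) \<psi> - 0) \<le> e)" using zs(1) by blast
qed

section \<open>Trigonometric polynomials on the dual group, and Bohr boxes\<close>

inductive trig_poly :: "'a::topological_ab_group_add set \<Rightarrow> ('a dual \<Rightarrow> complex) \<Rightarrow> bool" for H where
  ev: "a \<in> H \<Longrightarrow> trig_poly H (ev a)"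
| add: "trig_poly H f \<Longrightarrow> trig_poly H g \<Longrightarrow> trig_poly H (\<lambda>\<xi>. f \<xi> + g \<xi>)"
| cmult: "trig_poly H f \<Longrightarrow> trig_poly H (\<lambda>\<xi>. c * f \<xi>)"

lemma trig_poly_mult:
  assumes "is_subgroup H" "trig_poly H f" "trig_poly H g"
  shows "trig_poly H (\<lambda>\<xi>. f \<xi> * g \<xi>)"
  using assms(2)
proof induction
  case (ev a)
  from assms(3) show ?case
  proof induction
    case (ev b)
    have "trig_poly H (ev (a + b))"
      using ev \<open>a \<in> H\<close> assms(1) by (intro trig_poly.ev) (auto simp: is_subgroup_def)
    moreover have "ev (a + b) = (\<lambda>\<xi>. ev a \<xi> * ev b \<xi>)" by (simp add: fun_eq_iff ev_point_add)
    ultimately show ?case by simp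
  next
    case (add f g)
    then show ?case using trig_poly.add by (fastforce simp: distrib_left)
  next
    case (cmult f c)
    then show ?case using trig_poly.cmult[of H "\<lambda>\<xi>. ev a \<xi> * f \<xi>" c] by (simp add: mult.left_commute)
  qed
next
  case (add f g)
  then show ?case using trig_poly.add by (fastforce simp: distrib_right)
next
  case (cmult f c)
  then show ?case using trig_poly.cmult[of H "\<lambda>\<xi>. f \<xi> * g \<xi>" c] by (simp add: mult.assoc)
qed

lemma trig_poly_1:
  assumes "is_subgroup H"
  shows "trig_poly H (\<lambda>_. 1)"
proof -
  have "ev (0 :: 'a) = (\<lambda>_. 1)" by (rule ext) simp
  then show ?thesis using trig_poly.ev[of 0 H] assms by (simp add: is_subgroup_def)
qed

lemma trig_poly_power:
  assumes "is_subgroup H" "trig_poly H f"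
  shows "trig_poly H (\<lambda>\<xi>. f \<xi> ^ n)"
  by (induction n) (auto intro: assms trig_poly_1 trig_poly_mult)

lemma trig_poly_prod:
  assumes "is_subgroup H" "\<And>i. i \<in> I \<Longrightarrow> trig_poly H (f i)"
  shows "trig_poly H (\<lambda>\<xi>. \<Prod>i\<in>I. f i \<xi>)"
  using assms(2)
  by (induction I rule: infinite_finite_induct) (auto intro: trig_poly_1 trig_poly_mult assms(1))

text \<open>Multiplication by \<open>cnj (ev b)\<close> moves each frequency \<open>a\<close> in
  \<open>H\<close> to \<open>a - b\<close>, which is nonzero because \<open>b \<notin> H\<close>; by
  separation every term is then a nontrivial character of the dual.\<close>

lemma is_mean_trig_poly:
  fixes H :: "'a::topological_ab_group_add set"
  assumes sep: "\<And>a :: 'a. a \<noteq> 0 \<Longrightarrow> \<exists>\<xi>. ev a \<xi> \<noteq> 1"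
    and "trig_poly H f" "b \<notin> H"
  shows "is_mean (\<lambda>\<xi>. f \<xi> * cnj (ev b \<xi>)) 0"
  using assms(2)
proof induction
  case (ev a)
  have "a - b \<noteq> 0" using ev assms(3) by auto
  from sep[OF this] obtain \<xi> where "ev (a - b) \<xi> \<noteq> 1" ..
  then have "is_mean (ev (a - b)) 0" by (rule is_mean_ev)
  moreover have "ev (a - b) = (\<lambda>\<xi>. ev a \<xi> * cnj (ev b \<xi>))"
    using ev_point_add[of a "- b"] by (simp add: fun_eq_iff ev_point_minus)
  ultimately show ?case by simp
next
  case (add f g)
  from is_mean_add[OF add.IH] show ?case by (simp add: distrib_right)
next
  case (cmult f c)
  from is_mean_bounded_linear[OF bounded_linear_mult_right cmult.IH, of c] show ?case by (simp add: mult.assoc)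
qed

text \<open>The chord-length version of \<open>bohr_nbhd\<close>, carried over to the type
  \<open>dual\<close>.\<close>

definition bohr_box :: "'a::topological_ab_group_add set \<Rightarrow> real \<Rightarrow> 'a dual set" where
  "bohr_box A \<eta> = {\<xi>. \<forall>a\<in>A. cmod (ev a \<xi> - 1) \<le> \<eta>}"

text \<open>The values on \<open>A\<close> form vectors of bounded complex numbers, so a finite net
  \<open>J\<close> of characters exists; by \<open>ev_ratio\<close>, a character close to
  \<open>j\<close> on \<open>A\<close> differs from \<open>j\<close> by an element of the
  box.\<close>

lemma bohr_box_syndetic:
  assumes "finite A" "\<eta> > 0"
  obtains ps where "ps \<noteq> []" "\<And>\<xi>. \<exists>p\<in>set ps. \<xi> + p \<in> bohr_box A \<eta>"
proof -
  have "\<exists>J\<subseteq>UNIV. finite J \<and> (\<forall>\<xi>\<in>UNIV. \<exists>j\<in>J. \<forall>a\<in>A. norm (ev a \<xi> - ev a j) \<le> \<eta>)"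
    by (rule finite_net[where C = 1]) (use assms in auto)
  then obtain J where J: "finite J" "\<And>\<xi>. \<exists>j\<in>J. \<forall>a\<in>A. norm (ev a \<xi> - ev a j) \<le> \<eta>" by auto
  obtain ps where ps: "set ps = uminus ` J" using J(1) finite_list by (metis finite_imageI)
  have "\<exists>p\<in>set ps. \<xi> + p \<in> bohr_box A \<eta>" for \<xi>
    using J(2)[of \<xi>] ev_ratio[of _ \<xi>] by (auto simp: ps bohr_box_def)
  moreover from this have "ps \<noteq> []" by fastforce
  ultimately show ?thesis using that by blast
qed

section \<open>Duality for Bohr neighbourhoods\<close>

lemma norm_ev_minus_1: "(cmod (ev a \<xi> - 1))\<^sup>2 = 2 - 2 * Re (ev a \<xi>)"
  unfolding ev_def by (rule norm_circle_exp_minus_1)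

lemma Re_ev_bounds: "- 1 \<le> Re (ev a \<xi>)" "Re (ev a \<xi>) \<le> 1"
  using abs_Re_le_cmod[of "ev a \<xi>"] by auto

text \<open>The contradiction is quantitative: \<open>f\<close> never falls below
  \<open>- (\<kappa> ^ N)\<close>, yet it reaches \<open>s ^ N / 2\<close> at one of any
  \<open>n\<close> translates by \<open>ps\<close>, and for large \<open>N\<close> the gain
  wins.\<close>

theorem bohr_box_duality:
  fixes H :: "'a::topological_ab_group_add set"
  assumes sep: "\<And>a :: 'a. a \<noteq> 0 \<Longrightarrow> \<exists>\<xi>. ev a \<xi> \<noteq> 1"
    and H: "is_subgroup H" and A: "finite A" "A \<subseteq> H" and \<eta>: "0 < \<eta>" "\<eta> \<le> 1"
    and box: "\<And>\<xi>. \<xi> \<in> bohr_box A \<eta> \<Longrightarrow> Re (ev b \<xi>) \<ge> 1/2"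
  shows "b \<in> H"
proof (rule ccontr)
  assume b: "b \<notin> H"
  \<comment> \<open>Each factor equals \<open>1 - (cmod (ev a \<xi> - 1))\<^sup>2 / 4\<close>, so it
    measures how close \<open>ev a \<xi>\<close> is to 1.\<close>
  define q where "q \<xi> = (\<Prod>a\<in>A. (1 + Re (ev a \<xi>)) / 2)" for \<xi>
  have fac: "0 \<le> (1 + Re (ev a \<xi>)) / 2" "(1 + Re (ev a \<xi>)) / 2 \<le> 1" for a \<xi>
    using Re_ev_bounds[of a \<xi>] by auto
  have q0: "q \<xi> \<ge> 0" for \<xi> unfolding q_def by (intro prod_nonneg) (use fac in blast)
  \<comment> \<open>Outside the box one factor is at most this value; \<open>\<eta> \<le> 1\<close>
    keeps it positive.\<close>
  define \<kappa> where "\<kappa> = 1 - \<eta>\<^sup>2 / 4"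
  have "\<eta>\<^sup>2 \<le> 1" using power_mono[OF \<eta>(2), of 2] \<eta> by simp
  then have \<kappa>: "\<kappa> > 0" by (simp add: \<kappa>_def)
  have out: "q \<xi> \<le> \<kappa>" if out: "\<xi> \<notin> bohr_box A \<eta>" for \<xi>
  proof -
    obtain a where a: "a \<in> A" "cmod (ev a \<xi> - 1) > \<eta>" using out by (auto simp: bohr_box_def)
    have "\<eta>\<^sup>2 < (cmod (ev a \<xi> - 1))\<^sup>2" using a \<eta> by (intro power_strict_mono) auto
    then have le: "(1 + Re (ev a \<xi>)) / 2 \<le> \<kappa>" unfolding norm_ev_minus_1 \<kappa>_def by simp
    have "q \<xi> = (1 + Re (ev a \<xi>)) / 2 * (\<Prod>a\<in>A - {a}. (1 + Re (ev a \<xi>)) / 2)"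
      unfolding q_def by (rule prod.remove[OF A(1) a(1)])
    also have "\<dots> \<le> (1 + Re (ev a \<xi>)) / 2 * 1"
      by (intro mult_left_mono prod_le_1 conjI fac)
    finally show ?thesis using le by simp
  qed
  define t where "t = real (card A)"
  \<comment> \<open>A smaller box, on which the product of all factors still exceeds
    \<open>\<kappa>\<close>: the radius is chosen to make
    \<open>t * \<eta>'\<^sup>2 < \<eta>\<^sup>2\<close>, and the \<open>+ 1\<close> covers empty
    \<open>A\<close>.\<close>
  define \<eta>' where "\<eta>' = \<eta> / (t + 1)"
  have t: "t \<ge> 0" by (simp add: t_def)
  have \<eta>': "\<eta>' > 0" "\<eta>' \<le> \<eta>" using \<eta> t by (auto simp: \<eta>'_def field_simps)
  define s where "s = 1 - t * (\<eta>'\<^sup>2 / 4)"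
  have "t * \<eta>'\<^sup>2 < \<eta>\<^sup>2"
  proof -
    have "t * \<eta>'\<^sup>2 = t / (t + 1)\<^sup>2 * \<eta>\<^sup>2" by (simp add: \<eta>'_def power_divide)
    also have "\<dots> < 1 * \<eta>\<^sup>2"
    proof (rule mult_strict_right_mono)
      have "t < (t + 1)\<^sup>2" using t by (simp add: power2_eq_square algebra_simps add_pos_nonneg)
      then show "t / (t + 1)\<^sup>2 < 1" using t by (subst divide_less_eq_1_pos) auto
    qed (use \<eta> in auto)
    finally show ?thesis by simp
  qed
  then have s: "s > \<kappa>" by (simp add: s_def \<kappa>_def)
  have inn: "s \<le> q \<xi>" if inn: "\<xi> \<in> bohr_box A \<eta>'" for \<xi>
  proof -
    have "\<eta>'\<^sup>2 \<le> 1" using power_mono[of \<eta>' 1 2] \<eta>' \<eta> by simp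
    \<comment> \<open>Bernoulli's inequality bounds the product of the \<open>card A\<close> factors
      from below by \<open>s\<close>.\<close>
    have "s \<le> (1 + - (\<eta>'\<^sup>2 / 4)) ^ card A"
      using Bernoulli_inequality[of "- (\<eta>'\<^sup>2 / 4)" "card A"] \<open>\<eta>'\<^sup>2 \<le> 1\<close> by (simp add: s_def t_def)
    also have "\<dots> = (\<Prod>a\<in>A. 1 - \<eta>'\<^sup>2 / 4)" by simp
    also have "\<dots> \<le> q \<xi>" unfolding q_def
    proof (intro prod_mono conjI)
      fix a assume a: "a \<in> A"
      show "0 \<le> 1 - \<eta>'\<^sup>2 / 4" using \<open>\<eta>'\<^sup>2 \<le> 1\<close> by simp
      have "(cmod (ev a \<xi> - 1))\<^sup>2 \<le> \<eta>'\<^sup>2"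
        using inn a by (intro power_mono) (auto simp: bohr_box_def)
      then show "1 - \<eta>'\<^sup>2 / 4 \<le> (1 + Re (ev a \<xi>)) / 2" unfolding norm_ev_minus_1 by simp
    qed
    finally show ?thesis .
  qed
  obtain ps where ps: "ps \<noteq> []" "\<And>\<xi>. \<exists>p\<in>set ps. \<xi> + p \<in> bohr_box A \<eta>'"
    using bohr_box_syndetic[OF A(1) \<eta>'(1)] by blast
  define n where "n = real (length ps)"
  have n: "n > 0" using ps(1) by (simp add: n_def)
  \<comment> \<open>For this \<open>N\<close> the gain \<open>s ^ N / 2\<close>, guaranteed once
    among \<open>n\<close> translates, outweighs the loss \<open>\<kappa> ^ N\<close>.\<close>
  obtain N where "(\<kappa> / s) ^ N < 1 / (2 * n)"
    using real_arch_pow_inv[of "1 / (2 * n)" "\<kappa> / s"] n s \<kappa> by auto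
  then have N: "\<kappa> ^ N < s ^ N / (2 * n)" using s \<kappa> n by (simp add: power_divide field_simps)
  define f where "f \<xi> = q \<xi> ^ N * Re (ev b \<xi>)" for \<xi>
  \<comment> \<open>\<open>Re (ev a)\<close> is half the sum of \<open>ev a\<close> and
    \<open>ev (- a)\<close>, so \<open>q ^ N\<close> is a trigonometric polynomial with frequencies
    in \<open>H\<close>.\<close>
  have "trig_poly H (\<lambda>\<xi>. (\<Prod>a\<in>A. (1/2) * (1 + (1/2) * (ev a \<xi> + ev (- a) \<xi>))) ^ N)"
    using A(2) H unfolding is_subgroup_def
    by (intro trig_poly_power trig_poly_prod trig_poly.add trig_poly.cmult trig_poly_1 trig_poly.ev H) auto
  from is_mean_bounded_linear[OF bounded_linear_Re is_mean_trig_poly[OF sep this b]]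
  have "is_mean (\<lambda>\<xi>. Re ((\<Prod>a\<in>A. (1/2) * (1 + (1/2) * (ev a \<xi> + ev (- a) \<xi>))) ^ N * cnj (ev b \<xi>))) 0"
    by simp
  moreover have "(\<Prod>a\<in>A. (1/2) * (1 + (1/2) * (ev a \<xi> + ev (- a) \<xi>))) = of_real (q \<xi>)" for \<xi>
    unfolding q_def of_real_prod
    by (intro prod.cong refl) (simp add: ev_point_minus complex_add_cnj)
  ultimately have "is_mean f 0" by (simp add: f_def[abs_def] flip: of_real_power)
  from is_mean_add[OF this is_mean_const[of "\<kappa> ^ N"]] have "is_mean (\<lambda>\<xi>. f \<xi> + \<kappa> ^ N) (\<kappa> ^ N)" by simp
  from is_mean_add[OF is_mean_avg[OF this ps(1)] is_mean_const[of "- (s ^ N / (2 * n))"]]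
  have m: "is_mean (\<lambda>\<xi>. avg ps (\<lambda>\<xi>. f \<xi> + \<kappa> ^ N) \<xi> + - (s ^ N / (2 * n))) (\<kappa> ^ N + - (s ^ N / (2 * n)))" .
  \<comment> \<open>Only outside the box can \<open>Re (ev b \<xi>)\<close> be negative, and there
    \<open>q \<xi> ^ N \<le> \<kappa> ^ N\<close>.\<close>
  have nonneg: "f \<xi> + \<kappa> ^ N \<ge> 0" for \<xi>
  proof (cases "\<xi> \<in> bohr_box A \<eta>")
    case True
    then show ?thesis using box[OF True] q0[of \<xi>] \<kappa> by (simp add: f_def)
  next
    case False
    have "q \<xi> ^ N \<le> \<kappa> ^ N" by (intro power_mono out False q0)
    moreover have "q \<xi> ^ N * (- 1) \<le> f \<xi>" unfolding f_def
      by (intro mult_left_mono Re_ev_bounds) (simp add: q0)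
    ultimately show ?thesis by simp
  qed
  have "avg ps (\<lambda>\<xi>. f \<xi> + \<kappa> ^ N) \<xi> + - (s ^ N / (2 * n)) \<ge> 0" for \<xi>
  proof -
    obtain p where p: "p \<in> set ps" "\<xi> + p \<in> bohr_box A \<eta>'" using ps(2) by blast
    then have "\<xi> + p \<in> bohr_box A \<eta>" using \<eta>'(2) by (force simp: bohr_box_def)
    have "s ^ N * (1/2) \<le> f (\<xi> + p)" unfolding f_def
      by (intro mult_mono power_mono inn p box) (use s \<kappa> \<open>\<xi> + p \<in> bohr_box A \<eta>\<close> q0 in auto)
    also have "\<dots> \<le> f (\<xi> + p) + \<kappa> ^ N" using \<kappa> by simp
    also have "\<dots> \<le> (\<Sum>p\<leftarrow>ps. f (\<xi> + p) + \<kappa> ^ N)"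
      by (rule member_le_sum_list_real[OF p(1)]) (rule nonneg)
    finally have "s ^ N / 2 \<le> n * avg ps (\<lambda>\<xi>. f \<xi> + \<kappa> ^ N) \<xi>"
      using ps(1) by (simp add: avg_def n_def mult.assoc[symmetric])
    then show ?thesis using n by (simp add: field_simps)
  qed
  \<comment> \<open>The averaged function is nonnegative, but its mean
    \<open>\<kappa> ^ N - s ^ N / (2 * n)\<close> is negative.\<close>
  from is_mean_nonneg[OF m this] N show False by simp
qed

text \<open>If the dual were finite, each character would have finite order, so that a point would be
  determined by finitely many roots of unity.\<close>

lemma infinite_dual:
  assumes sep: "\<And>a :: 'a::topological_ab_group_add. a \<noteq> 0 \<Longrightarrow> \<exists>\<xi>. ev a \<xi> \<noteq> 1"
    and inf: "infinite (UNIV :: 'a set)"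
  shows "infinite (UNIV :: 'a dual set)"
proof
  assume fin: "finite (UNIV :: 'a dual set)"
  have "\<exists>n>0. \<forall>a. ev a \<xi> ^ n = 1" for \<xi> :: "'a dual"
  proof -
    \<comment> \<open>\<open>((+) \<xi> ^^ i) 0\<close> is the \<open>i\<close>-fold multiple of
      \<open>\<xi>\<close>; two multiples must coincide in a finite dual.\<close>
    have pow: "ev a (((+) \<xi> ^^ i) 0) = ev a \<xi> ^ i" for a i
      by (induction i) (auto simp: ev_add)
    have "\<not> inj (\<lambda>i. ((+) \<xi> ^^ i) 0)"
      using fin finite_imageD[of "\<lambda>i. ((+) \<xi> ^^ i) 0" UNIV] finite_subset[OF subset_UNIV fin] by blast
    then obtain i j where ij: "i < j" "((+) \<xi> ^^ i) 0 = ((+) \<xi> ^^ j) 0"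
      unfolding inj_def by (metis linorder_neqE_nat)
    have "ev a \<xi> ^ (j - i) = 1" for a
    proof -
      have "ev a \<xi> ^ i = ev a \<xi> ^ j" using ij(2) pow by metis
      also have "\<dots> = ev a \<xi> ^ i * ev a \<xi> ^ (j - i)" using ij(1) by (simp flip: power_add)
      finally show ?thesis using norm_ev[of a \<xi>] by (cases "ev a \<xi> = 0") auto
    qed
    then show ?thesis using ij(1) by (intro exI[of _ "j - i"]) auto
  qed
  then obtain n where n: "\<And>\<xi> :: 'a dual. n \<xi> > 0" "\<And>\<xi> a. ev a \<xi> ^ n \<xi> = 1" by metis
  have "finite (PiE UNIV (\<lambda>\<xi> :: 'a dual. {z::complex. z ^ n \<xi> = 1}))"
    by (intro finite_PiE fin finite_roots_unity) (use n(1) in \<open>auto simp: Suc_leI\<close>)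
  moreover have "range ev \<subseteq> PiE UNIV (\<lambda>\<xi> :: 'a dual. {z::complex. z ^ n \<xi> = 1})" using n(2) by auto
  ultimately have "finite (range (ev :: 'a \<Rightarrow> _))" by (rule finite_subset[rotated])
  moreover have "inj (ev :: 'a \<Rightarrow> _)"
  proof (rule injI, rule ccontr)
    fix a b :: 'a assume eq: "ev a = ev b" and "a \<noteq> b"
    then obtain \<xi> where "ev (a - b) \<xi> \<noteq> 1" using sep[of "a - b"] by auto
    moreover have "ev (a - b) \<xi> = ev a \<xi> * cnj (ev b \<xi>)"
      using ev_point_add[of a "- b" \<xi>] by (simp add: ev_point_minus)
    ultimately show False by (simp add: eq)
  qed
  ultimately show False using inf finite_imageD by blast
qed

text \<open>Finitely many translates of the box cover the infinite dual.\<close>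

lemma infinite_bohr_box:
  assumes "infinite (UNIV :: 'a::topological_ab_group_add dual set)" "finite A" "\<eta> > 0"
  shows "infinite (bohr_box A \<eta> :: 'a dual set)"
proof
  assume fin: "finite (bohr_box A \<eta> :: 'a dual set)"
  obtain ps :: "'a dual list" where ps: "\<And>\<xi>. \<exists>p\<in>set ps. \<xi> + p \<in> bohr_box A \<eta>"
    using bohr_box_syndetic[OF assms(2,3)] by metis
  have "UNIV \<subseteq> (\<Union>p\<in>set ps. (\<lambda>\<psi>. \<psi> - p) ` bohr_box A \<eta>)"
  proof
    fix \<xi> :: "'a dual"
    obtain p where "p \<in> set ps" "\<xi> + p \<in> bohr_box A \<eta>" using ps by blast
    then show "\<xi> \<in> (\<Union>p\<in>set ps. (\<lambda>\<psi>. \<psi> - p) ` bohr_box A \<eta>)"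
      by (intro UN_I[of p] image_eqI[of _ _ "\<xi> + p"]) auto
  qed
  moreover have "finite (\<Union>p\<in>set ps. (\<lambda>\<psi>. \<psi> - p) ` bohr_box A \<eta>)" using fin by auto
  ultimately show False using assms(1) finite_subset by blast
qed

text \<open>Write \<open>\<xi> = (\<xi> + \<psi>) - \<psi>\<close> with \<open>\<psi>\<close> such that neither term is exceptional.\<close>

lemma bohr_box_finite_exception:
  assumes inf: "infinite (UNIV :: 'a::topological_ab_group_add dual set)"
    and A: "finite A" and \<eta>: "\<eta> > 0" and \<Gamma>: "finite \<Gamma>"
    and near: "\<And>\<xi> :: 'a dual. \<xi> \<in> bohr_box A \<eta> - \<Gamma> \<Longrightarrow> cmod (ev b \<xi> - 1) \<le> \<delta>"
    and \<xi>: "\<xi> \<in> bohr_box A (\<eta> / 2)"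
  shows "cmod (ev b \<xi> - 1) \<le> 2 * \<delta>"
proof -
  have "infinite (bohr_box A (\<eta> / 2) :: 'a dual set)"
    using \<eta> by (intro infinite_bohr_box inf A) simp
  \<comment> \<open>\<open>\<psi>\<close> has to avoid \<open>\<Gamma>\<close> and, so that
    \<open>\<xi> + \<psi>\<close> does too, the translate of \<open>\<Gamma>\<close> by
    \<open>- \<xi>\<close>.\<close>
  moreover have "finite (\<Gamma> \<union> (\<lambda>\<gamma>. \<gamma> - \<xi>) ` \<Gamma>)" using \<Gamma> by simp
  ultimately have "bohr_box A (\<eta> / 2) - (\<Gamma> \<union> (\<lambda>\<gamma>. \<gamma> - \<xi>) ` \<Gamma>) \<noteq> {}"
    by (metis Diff_infinite_finite finite.emptyI)
  then obtain \<psi> where \<psi>: "\<psi> \<in> bohr_box A (\<eta> / 2)" "\<psi> \<notin> \<Gamma>" "\<psi> \<notin> (\<lambda>\<gamma>. \<gamma> - \<xi>) ` \<Gamma>" by blast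
  have "\<xi> + \<psi> \<notin> \<Gamma>"
  proof
    assume "\<xi> + \<psi> \<in> \<Gamma>"
    then have "(\<xi> + \<psi>) - \<xi> \<in> (\<lambda>\<gamma>. \<gamma> - \<xi>) ` \<Gamma>" by (rule imageI)
    then show False using \<psi>(3) by simp
  qed
  moreover have "\<psi> \<in> bohr_box A \<eta>" using \<psi>(1) \<eta> by (force simp: bohr_box_def)
  \<comment> \<open>The two half radii add up, since \<open>cmod (z * w - 1)\<close> is at most
    \<open>cmod (z - 1) + cmod (w - 1)\<close> on the unit circle.\<close>
  moreover have "\<xi> + \<psi> \<in> bohr_box A \<eta>"
    unfolding bohr_box_def
  proof safe
    fix a assume a: "a \<in> A"
    have "ev a (\<xi> + \<psi>) - 1 = (ev a \<xi> - 1) * ev a \<psi> + (ev a \<psi> - 1)" by (simp add: ev_add algebra_simps)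
    also have "cmod \<dots> \<le> \<eta> / 2 + \<eta> / 2"
      by (intro norm_triangle_mono) (use a \<xi> \<psi>(1) in \<open>auto simp: bohr_box_def norm_mult\<close>)
    finally show "cmod (ev a (\<xi> + \<psi>) - 1) \<le> \<eta>" by simp
  qed
  ultimately have n: "cmod (ev b \<psi> - 1) \<le> \<delta>" "cmod (ev b (\<xi> + \<psi>) - 1) \<le> \<delta>" using \<psi>(2) near by auto
  have "cmod (ev b \<xi> - 1) = cmod (ev b (\<xi> + \<psi>) - ev b \<psi>)"
    using ev_ratio[of b "\<xi> + \<psi>" \<psi>] by simp
  also have "\<dots> = cmod ((ev b (\<xi> + \<psi>) - 1) - (ev b \<psi> - 1))" by simp
  also have "\<dots> \<le> \<delta> + \<delta>" by (intro order_trans[OF norm_triangle_ineq4 add_mono] n)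
  finally show ?thesis by simp
qed

section \<open>Limits along the filter and membership in the subgroup\<close>

theorem theorem2p1:
  fixes H :: "'a::{topological_ab_group_add, t2_space} set"
  assumes "infinite (UNIV :: 'a set)"
    and "compact (UNIV :: 'a set)"
    and "is_subgroup H"
  shows "\<forall>\<beta>. ((\<lambda>\<phi>. \<phi> \<beta>) \<longlongrightarrow> 0) (char_filter H) \<longleftrightarrow> \<beta> \<in> H"
proof (intro allI iffI)
  fix \<beta> :: 'a
  assume \<beta>: "\<beta> \<in> H"
  show "((\<lambda>\<phi>. \<phi> \<beta>) \<longlongrightarrow> 0) (char_filter H)"
  proof (rule topological_tendstoI)
    fix U :: "circle set" assume "open U" "0 \<in> U"
    then obtain \<epsilon> where \<epsilon>: "\<epsilon> > 0" "\<And>a. circle_norm a \<le> \<epsilon> \<Longrightarrow> a \<in> U" using circle_norm_nhds_0 by blast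
    \<comment> \<open>The Bohr neighbourhood given by \<open>\<beta>\<close> alone suffices, with no
      exceptions.\<close>
    have "bohr_nbhd [\<beta>] \<epsilon> \<inter> (dual_group - {}) \<subseteq> {\<phi> \<in> dual_group. \<phi> \<beta> \<in> U}"
      using \<epsilon>(2) by (auto simp: bohr_nbhd_def)
    moreover have "set [\<beta>] \<subseteq> H" using \<beta> by simp
    ultimately show "\<forall>\<^sub>F \<phi> in char_filter H. \<phi> \<beta> \<in> U"
      unfolding eventually_char_filter char_filter_sets_def using \<epsilon>(1) by blast
  qed
next
  fix \<beta> :: 'a
  assume lim: "((\<lambda>\<phi>. \<phi> \<beta>) \<longlongrightarrow> 0) (char_filter H)"
  have sep: "\<exists>\<xi>. ev a \<xi> \<noteq> 1" if "a \<noteq> 0" for a :: 'a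
    using dual_separates_points[OF assms(2) that] by metis
  \<comment> \<open>Radius 1/4, because removing the exceptions doubles it, and distance at most 1/2
    from 1 gives \<open>Re (ev \<beta> \<xi>) \<ge> 1/2\<close>.\<close>
  define U where "U = circle_exp -` ball 1 (1/4)"
  have "open U" "0 \<in> U" unfolding U_def using continuous_circle_exp by (auto intro: open_vimage)
  from topological_tendstoD[OF lim this]
  obtain \<alpha>s \<epsilon> \<Gamma> where 1: "set \<alpha>s \<subseteq> H" "\<epsilon> > 0" "\<Gamma> \<subseteq> dual_group" "finite \<Gamma>"
    "bohr_nbhd \<alpha>s \<epsilon> \<inter> (dual_group - \<Gamma>) \<subseteq> {\<phi> \<in> dual_group. \<phi> \<beta> \<in> U}"
    unfolding eventually_char_filter char_filter_sets_def by blast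
  obtain \<eta>0 where \<eta>0: "\<eta>0 > 0" "\<And>a. cmod (circle_exp a - 1) \<le> \<eta>0 \<Longrightarrow> circle_norm a \<le> \<epsilon>"
    using circle_norm_le_if_exp_near_1[OF 1(2)] by blast
  \<comment> \<open>Capped at 2, since \<open>bohr_box_duality\<close> is applied with
    \<open>\<eta> / 2\<close> and asks for a radius at most 1.\<close>
  define \<eta> where "\<eta> = min \<eta>0 2"
  have \<eta>: "\<eta> > 0" "\<eta> \<le> \<eta>0" "\<eta> / 2 > 0" "\<eta> / 2 \<le> 1" using \<eta>0(1) by (auto simp: \<eta>_def)
  \<comment> \<open>By the choice of \<open>\<eta>0\<close> the box lies inside
    \<open>bohr_nbhd\<close>; \<open>Abs_dual\<close> carries the exceptions over to the type
    \<open>dual\<close>.\<close>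
  have near: "cmod (ev \<beta> \<xi> - 1) \<le> 1/4" if \<xi>: "\<xi> \<in> bohr_box (set \<alpha>s) \<eta> - Abs_dual ` \<Gamma>" for \<xi>
  proof -
    have "Rep_dual \<xi> \<in> dual_group" by (rule Rep_dual)
    moreover have "Rep_dual \<xi> \<notin> \<Gamma>" using \<xi> Rep_dual_inverse by (metis DiffD2 imageI)
    moreover have "circle_norm (Rep_dual \<xi> a) \<le> \<epsilon>" if "a \<in> set \<alpha>s" for a
      using \<xi> that \<eta>(2) by (intro \<eta>0) (force simp: bohr_box_def ev_def)
    ultimately have "Rep_dual \<xi> \<beta> \<in> U" using 1(5) by (auto simp: bohr_nbhd_def)
    then show ?thesis by (simp add: U_def ev_def dist_norm norm_minus_commute)
  qed
  have "Re (ev \<beta> \<xi>) \<ge> 1/2" if "\<xi> \<in> bohr_box (set \<alpha>s) (\<eta> / 2)" for \<xi>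
  proof -
    have "cmod (ev \<beta> \<xi> - 1) \<le> 2 * (1/4)"
      by (rule bohr_box_finite_exception[OF infinite_dual[OF sep assms(1)] _ \<eta>(1) _ near that])
         (use 1 in auto)
    then show ?thesis using abs_Re_le_cmod[of "ev \<beta> \<xi> - 1"] by simp
  qed
  then show "\<beta> \<in> H"
    using bohr_box_duality[OF sep assms(3) _ 1(1) \<eta>(3,4)] by blast
qed

end
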